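(* For a nonnegative integer $n$, let $p_{1,3}(n)$ be defined by $\sum_{n\geq0}p_{1,3}(n)q^n=\prod_{m\geq1}(1-q^m)^{-6}$. Then for all integers $n\geq0$ and $\alpha\geq1$, \begin{align*} p_{1,3}\left(3^{2\alpha-1}n+\tfrac{3^{2\alpha-1}+1}{4}\right) &\equiv0\pmod{3^{2\alpha-1}},\\ p_{1,3}\left(3^{2\alpha+1}n+\tfrac{7\cdot3^{2\alpha}+1}{4}\right) &\equiv0\pmod{3^{2\alpha+3}},\\ p_{1,3}\left(3^{2\alpha+1}n+\tfrac{11\cdot3^{2\alpha}+1}{4}\right) &\equiv0\pmod{3^{2\alpha+4}},\\ p_{1,3}\left(3^{2\alpha}n+\tfrac{5\cdot3^{2\alpha-1}+1}{4}\right) &\equiv0\pmod{3^{2\alpha}},\\ p_{1,3}\left(3^{2\alpha}n+\tfrac{3^{2\alpha+1}+1}{4}\right) &\equiv0\pmod{3^{2\alpha+1}}. \end{align*}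
   Context: In general $p_{k,3}(n)$ is defined by $\sum_{n\ge0}p_{k,3}(n)q^n=\frac{1}{(q;q)_\infty^3(q^k;q^k)_\infty^3}$ where $(a;q)_\infty=\prod_{n\ge0}(1-aq^n)$; it counts 2-color partition triples of $n$ where one of the colors appears only in parts that are multiples of $k$. Here $k=1$. *)

theory Defs
  imports "HOL-Analysis.Infinite_Products"
    "HOL-Computational_Algebra.Formal_Power_Series"
    "HOL-Number_Theory.Cong"
begin

text \<open>
  The factor $(1 - q^m)^{-6}$ of the generating function, as a formal power series over the
  integers. The integers have no \<^const>\<open>inverse\<close>, so the reciprocal is expressed by
  \<^term>\<open>fps_right_inverse f y\<close>, the power series reciprocal of \<open>f\<close> with constant
  coefficient \<open>y\<close>.
\<close>

definition p13_factor :: "nat \<Rightarrow> int fps" where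
  "p13_factor m = fps_right_inverse ((1 - fps_X ^ m) ^ 6) 1"

text \<open>
  The infinite product is the limit of the partial products in the $q$-adic topology on
  formal power series. Its index starts at $0$, hence the successor.
\<close>

definition p13 :: "nat \<Rightarrow> int" where
  "p13 n = fps_nth (\<Prod>m. p13_factor (Suc m)) n"

lemma p13_factor_inverse:
  assumes "m > 0"
  shows "(1 - fps_X ^ m) ^ 6 * p13_factor m = 1"
  unfolding p13_factor_def
  by (rule fps_right_inverse) (use assms in \<open>simp add: fps_nth_power_0 power_0_left\<close>)

lemma p13_factor_nonzero: "p13_factor (Suc m) \<noteq> 0"
  using p13_factor_inverse[of "Suc m"] by auto

text \<open>The product converges, so that \<^const>\<open>p13\<close> is given by the intended generating function.\<close>

lemma p13_has_prod: "(\<lambda>m. p13_factor (Suc m)) has_prod Abs_fps p13"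
proof -
  have sub: "subdegree (p13_factor (Suc k) - 1) > n" if "k > n" for n k
  proof -
    define Y where "Y = (fps_X :: int fps) ^ Suc k"
    define u where "u = p13_factor (Suc k)"
    have u: "(1 - Y) ^ 6 * u = 1"
      unfolding Y_def u_def by (rule p13_factor_inverse) simp
    have "(1 - Y) ^ 6 - 1 = Y * (- 6 + 15 * Y - 20 * Y^2 + 15 * Y^3 - 6 * Y^4 + Y^5)"
      by algebra
    moreover have "u - 1 = - u * ((1 - Y) ^ 6 - 1)"
      using u by (simp add: algebra_simps)
    ultimately obtain W where W: "u - 1 = Y * W"
      by (metis mult.left_commute)
    have "u - 1 \<noteq> 0"
    proof
      assume "u - 1 = 0"
      hence "(1 - Y) ^ 6 = 1" using u by simp
      hence "Y * (- 6 + 15 * Y - 20 * Y^2 + 15 * Y^3 - 6 * Y^4 + Y^5) = 0"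
        using \<open>(1 - Y) ^ 6 - 1 = _\<close> by simp
      moreover have "Y \<noteq> 0" by (simp add: Y_def)
      ultimately have "- 6 + 15 * Y - 20 * Y^2 + 15 * Y^3 - 6 * Y^4 + Y^5 = 0" by simp
      hence "fps_nth (- 6 + 15 * Y - 20 * Y^2 + 15 * Y^3 - 6 * Y^4 + Y^5) 0 = 0" by simp
      thus False by (simp add: Y_def fps_nth_power_0 numeral_fps_const)
    qed
    hence "W \<noteq> 0" "Y \<noteq> 0" using W by auto
    hence "subdegree (u - 1) = Suc k + subdegree W"
      unfolding W by (simp add: Y_def fps_subdegree_mult_fps_X_power)
    thus ?thesis using that by (simp add: u_def)
  qed
  obtain P where lim: "(\<lambda>n. \<Prod>k\<le>n. p13_factor (Suc k)) \<longlonglongrightarrow> P"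
    using tendsto_prod_fps[of "\<lambda>k. p13_factor (Suc k)" "\<lambda>n. n"] sub p13_factor_nonzero by blast
  have one: "fps_nth (\<Prod>k\<le>n. p13_factor (Suc k)) 0 = 1" for n
    by (induction n) (simp_all add: p13_factor_def)
  from lim have "\<forall>\<^sub>F n in sequentially. fps_nth (\<Prod>k\<le>n. p13_factor (Suc k)) 0 = fps_nth P 0"
    by (simp add: tendsto_fps_iff)
  hence "P \<noteq> 0" using one by (auto simp: eventually_sequentially)
  with lim have "(\<lambda>m. p13_factor (Suc m)) has_prod P"
    by (simp add: has_prod_def raw_has_prod_def)
  moreover from this have "Abs_fps p13 = P"
    by (auto simp: p13_def fps_eq_iff dest: has_prod_unique)
  ultimately show ?thesis by simp
qed

end

theory Submission
  imports Defs "HOL-Computational_Algebra.Polynomial" "HOL-Computational_Algebra.Formal_Laurent_Series"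
begin

text \<open>
  Write \<open>E = \<Prod>m. (1 - q\<^sup>m)\<close>, so that the generating function is \<open>E(q)\<^sup>-\<^sup>6\<close>. Jacobi's identity
  \<open>E\<^sup>3 = \<Sum>l. (-1)\<^sup>l (2l + 1) q\<^bsup>l(l+1)/2\<^esup>\<close> gives a two-term dissection \<open>E(q)\<^sup>3 = A(q\<^sup>3) - 3 q E(q\<^sup>9)\<^sup>3\<close>.
  Multiplying its three conjugates under \<open>q \<mapsto> \<omega> q\<close>, \<open>\<omega>\<^sup>3 = 1\<close>, yields
  \<open>A\<^sup>3 = E(q)\<^sup>1\<^sup>2 E(q\<^sup>3)\<^sup>-\<^sup>3 (1 + \<tau>)\<close> with \<open>\<tau> = 27 q E(q\<^sup>3)\<^sup>1\<^sup>2 E(q)\<^sup>-\<^sup>1\<^sup>2\<close>.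
  Hence extracting every third coefficient acts on polynomials in \<open>\<tau>\<close>. Let \<open>\<theta> = 9 q\<^sup>2 E(q\<^sup>9)\<^sup>6 E(q)\<^sup>-\<^sup>6\<close>.
  Then \<open>\<tau>(q) \<tau>(q\<^sup>3) = 9 \<theta>\<^sup>2\<close>, while \<open>\<theta>\<^sup>m\<close> is mapped to an integral polynomial in \<open>\<tau>\<close> divisible
  by a high power of \<open>\<tau>\<close>; so \<open>\<tau>\<^sup>i\<close> and \<open>\<theta> \<tau>\<^sup>i\<close> are both mapped to \<open>9\<^sup>i\<close> times such a polynomial,
  and every second extraction gains a factor \<open>9\<close>. The extra divisibility in the
  remaining congruences comes from the coefficients of \<open>(x\<^sup>2 + 3x + 9)\<^sup>k\<close> in the term linear in \<open>\<tau>\<close>.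
\<close>

subsection \<open>Jacobi's identity for the cube of the Euler product\<close>

lemma fps_X_power_dvd_iff:
  fixes f :: "'a :: comm_ring_1 fps"
  shows "fps_X ^ n dvd f \<longleftrightarrow> (\<forall>k<n. f $ k = 0)"
proof
  assume "fps_X ^ n dvd f"
  then obtain g where "f = fps_X ^ n * g" by (rule dvdE)
  then show "\<forall>k<n. f $ k = 0" by (simp add: fps_X_power_mult_nth)
next
  assume *: "\<forall>k<n. f $ k = 0"
  have "f = fps_X ^ n * fps_shift n f"
    using * by (auto simp: fps_eq_iff fps_X_power_mult_nth)
  then show "fps_X ^ n dvd f" by (metis dvd_triv_left)
qed

lemma fps_eqI_dvd:
  fixes f g :: "'a :: comm_ring_1 fps"
  assumes "\<And>n. fps_X ^ Suc n dvd f - g"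
  shows "f = g"
proof (rule fps_ext)
  fix n
  show "f $ n = g $ n"
    using assms[of n] unfolding fps_X_power_dvd_iff by auto
qed

lemma dvd_diff_mult:
  fixes a b c d m :: "'a :: comm_ring_1"
  assumes "m dvd a - b" "m dvd c - d"
  shows "m dvd a * c - b * d"
proof -
  have "a * c - b * d = (a - b) * c + b * (c - d)" by (simp add: algebra_simps)
  then show ?thesis using assms by (simp add: dvd_add)
qed

lemma dvd_diff_power:
  fixes a b m :: "'a :: comm_ring_1"
  assumes "m dvd a - b"
  shows "m dvd a ^ n - b ^ n"
  by (induction n) (auto intro: dvd_diff_mult assms)

lemma dvd_diff_trans:
  fixes a b c m :: "'a :: comm_ring_1"
  assumes "m dvd a - b" "m dvd b - c"
  shows "m dvd a - c"
  using dvd_add[OF assms] by simp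

lemma dvd_diff_sym:
  fixes a b m :: "'a :: comm_ring_1"
  shows "m dvd a - b \<Longrightarrow> m dvd b - a"
  by (metis dvd_minus_iff minus_diff_eq)

definition qpoch :: "nat \<Rightarrow> int fps" where
  "qpoch n = (\<Prod>m<n. 1 - fps_X ^ Suc m)"

lemma qpoch_0 [simp]: "qpoch 0 = 1"
  by (simp add: qpoch_def)

lemma qpoch_Suc: "qpoch (Suc n) = qpoch n * (1 - fps_X ^ Suc n)"
  by (simp add: qpoch_def)

lemma qpoch_nth_0 [simp]: "qpoch n $ 0 = 1"
  by (induction n) (simp_all add: qpoch_Suc)

lemma qpoch_nonzero [simp]: "qpoch n \<noteq> 0"
  using qpoch_nth_0[of n] by (metis fps_zero_nth zero_neq_one)

lemma qpoch_dvd_diff: "m \<le> n \<Longrightarrow> fps_X ^ Suc m dvd qpoch n - qpoch m"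
proof (induction n rule: dec_induct)
  case (step n)
  have "(fps_X :: int fps) ^ Suc m dvd fps_X ^ Suc n"
    using step by (intro le_imp_power_dvd) auto
  then have "fps_X ^ Suc m dvd qpoch (Suc n) - qpoch n"
    by (simp add: qpoch_Suc algebra_simps del: power_Suc)
  then show ?case using step.IH by (rule dvd_diff_trans)
qed simp

text \<open>Factors of index above n are 1 modulo q^(n+1), so the n-th coefficient of the infinite
  product is already that of \<open>qpoch n\<close>.\<close>

definition euler :: "int fps" where
  "euler = Abs_fps (\<lambda>n. qpoch n $ n)"

lemma euler_dvd_diff: "fps_X ^ Suc n dvd euler - qpoch n"
  unfolding fps_X_power_dvd_iff
proof (intro allI impI)
  fix k assume "k < Suc n"
  then have "fps_X ^ Suc k dvd qpoch n - qpoch k" by (intro qpoch_dvd_diff) simp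
  then show "(euler - qpoch n) $ k = 0"
    unfolding fps_X_power_dvd_iff by (auto simp: euler_def)
qed

definition euler_inv :: "int fps" where
  "euler_inv = fps_right_inverse euler 1"

lemma euler_inv: "euler_inv * euler = 1"
proof -
  have "euler * fps_right_inverse euler 1 = 1"
    by (rule fps_right_inverse) (simp add: euler_def)
  then show ?thesis by (simp add: euler_inv_def mult.commute)
qed

section \<open>Gaussian binomial coefficients and the q-binomial theorem\<close>

fun qbinom :: "nat \<Rightarrow> nat \<Rightarrow> int fps" where
  "qbinom n 0 = 1"
| "qbinom 0 (Suc k) = 0"
| "qbinom (Suc n) (Suc k) = qbinom n k + fps_X ^ Suc k * qbinom n (Suc k)"

lemma qbinom_eq_0: "n < k \<Longrightarrow> qbinom n k = 0"
  by (induction n k rule: qbinom.induct) auto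

lemma qbinom_same [simp]: "qbinom n n = 1"
  by (induction n) (auto simp: qbinom_eq_0)

text \<open>Pascal's rule reduces this to 1 - q^(a+b) = (1 - q^a) + q^a (1 - q^b).\<close>

lemma qbinom_qpoch: "qbinom (a + b) a * qpoch a * qpoch b = qpoch (a + b)"
proof (induction "a + b" arbitrary: a b)
  case (Suc n)
  show ?case
  proof (cases a; cases b)
    fix a' b' assume a: "a = Suc a'" and b: "b = Suc b'"
    have IH1: "qbinom (a' + b) a' * qpoch a' * qpoch b = qpoch (a' + b)"
      using Suc a by (intro Suc) auto
    have IH2: "qbinom (a + b') a * qpoch a * qpoch b' = qpoch (a + b')"
      using Suc b by (intro Suc) auto
    have s: "a' + b = a + b'" using a b by simp
    have "qbinom (a + b) a * qpoch a * qpoch b =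
      (qbinom (a' + b) a' * qpoch a' * qpoch b) * (1 - fps_X ^ a)
        + fps_X ^ a * (qbinom (a + b') a * qpoch a * qpoch b') * (1 - fps_X ^ b)"
      by (simp add: a b qpoch_Suc algebra_simps)
    also have "\<dots> = qpoch (a + b') * ((1 - fps_X ^ a) + fps_X ^ a * (1 - fps_X ^ b))"
      by (simp only: IH1 IH2) (simp add: s algebra_simps)
    also have "(1 - fps_X ^ a) + fps_X ^ a * (1 - fps_X ^ b) = 1 - (fps_X :: int fps) ^ (a + b)"
      by (simp add: algebra_simps power_add)
    also have "qpoch (a + b') * (1 - fps_X ^ (a + b)) = qpoch (a + b)"
      using b by (simp add: qpoch_Suc)
    finally show ?thesis .
  qed auto
qed simp

text \<open>Polynomial arguments allow differentiation in an indeterminate later. Splitting off the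
  factor x + y replaces y by q y in the rest, hence the induction over arbitrary y.\<close>

lemma qbinomial_theorem:
  fixes x y :: "int fps poly"
  shows "(\<Prod>j<n. x + y * [:fps_X ^ j:]) =
    (\<Sum>k\<le>n. [:qbinom n k * fps_X ^ (k choose 2):] * y ^ k * x ^ (n - k))"
proof (induction n arbitrary: y)
  case (Suc n)
  define c where "c n k = [:qbinom n k * fps_X ^ (k choose 2):]" for n k
  define q where "q j = [:(fps_X :: int fps) ^ j:]" for j
  have qpow: "q i ^ k = q (i * k)" for i k
    by (induction k) (simp_all add: q_def power_add one_pCons)
  have c0: "c m 0 = 1" for m by (simp add: c_def one_pCons numeral_2_eq_2)
  have cS: "c (Suc n) (Suc k) = c n k * q k + c n (Suc k) * q (Suc k)" for k
    by (simp add: c_def q_def numeral_2_eq_2 power_add algebra_simps)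
  have "(\<Prod>j<Suc n. x + y * q j) = (x + y) * (\<Prod>j<n. x + (y * q 1) * q j)"
    by (subst prod.lessThan_Suc_shift) (simp add: q_def one_pCons mult.commute)
  also have "(\<Prod>j<n. x + (y * q 1) * q j) = (\<Sum>k\<le>n. c n k * (y * q 1) ^ k * x ^ (n - k))"
    using Suc.IH[of "y * q 1"] by (simp only: c_def q_def)
  also have "\<dots> = (\<Sum>k\<le>n. c n k * q k * y ^ k * x ^ (n - k))"
    by (intro sum.cong) (simp_all add: power_mult_distrib qpow mult_ac)
  also have "(x + y) * \<dots> = (\<Sum>k\<le>n. c n k * q k * y ^ k * x ^ (Suc n - k))
      + (\<Sum>k\<le>n. c n k * q k * y ^ Suc k * x ^ (n - k))"
    by (subst distrib_right) (simp add: sum_distrib_left Suc_diff_le mult_ac)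
  also have "(\<Sum>k\<le>n. c n k * q k * y ^ k * x ^ (Suc n - k))
      = (\<Sum>k\<le>Suc n. c n k * q k * y ^ k * x ^ (Suc n - k))"
    by (simp add: c_def qbinom_eq_0)
  also have "\<dots> = x ^ Suc n + (\<Sum>k\<le>n. c n (Suc k) * q (Suc k) * y ^ Suc k * x ^ (n - k))"
    by (subst sum.atMost_Suc_shift) (simp add: c0 q_def one_pCons)
  also have "\<dots> + (\<Sum>k\<le>n. c n k * q k * y ^ Suc k * x ^ (n - k))
      = x ^ Suc n + (\<Sum>k\<le>n. c (Suc n) (Suc k) * y ^ Suc k * x ^ (n - k))"
    by (simp add: cS distrib_right sum.distrib)
  also have "\<dots> = (\<Sum>k\<le>Suc n. c (Suc n) k * y ^ k * x ^ (Suc n - k))"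
    by (subst sum.atMost_Suc_shift) (simp add: c0)
  finally show ?case by (simp only: c_def q_def)
qed (simp add: one_pCons numeral_2_eq_2)


lemma qbinom_sym: "qbinom (a + b) a = qbinom (a + b) b"
proof -
  have "qbinom (a + b) a * (qpoch a * qpoch b) = qbinom (a + b) b * (qpoch a * qpoch b)"
    using qbinom_qpoch[of a b] qbinom_qpoch[of b a] by (simp add: mult_ac add.commute)
  then show ?thesis by simp
qed

lemma prod_lessThan_add:
  fixes f :: "nat \<Rightarrow> 'a :: comm_monoid_mult"
  shows "(\<Prod>j<m + n. f j) = (\<Prod>j<m. f j) * (\<Prod>j<n. f (m + j))"
  by (induction n) (simp_all add: mult.assoc)

lemma sum_lessThan_add:
  fixes f :: "nat \<Rightarrow> 'a :: comm_monoid_add"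
  shows "(\<Sum>j<m + n. f j) = (\<Sum>j<m. f j) + (\<Sum>j<n. f (m + j))"
  by (induction n) (simp_all add: add.assoc)

lemma int_choose_two: "2 * int (n choose 2) = int n * (int n - 1)"
  by (induction n) (simp_all add: numeral_2_eq_2 algebra_simps)

lemma sum_choose_two: "(\<Sum>j<n. j) = n choose 2"
  by (induction n) (simp_all add: numeral_2_eq_2)

lemma prod_X_power_below:
  "(\<Prod>j<n. fps_X ^ n - fps_X ^ j) = (-1) ^ n * fps_X ^ (n choose 2) * qpoch n"
proof -
  have "(\<Prod>j<n. fps_X ^ n - fps_X ^ j) = (\<Prod>j<n. (-1) * fps_X ^ j * (1 - (fps_X :: int fps) ^ (n - j)))"
    by (intro prod.cong) (simp_all add: algebra_simps flip: power_add)
  also have "\<dots> = (\<Prod>j<n. -1) * (\<Prod>j<n. fps_X ^ j) * (\<Prod>j<n. 1 - fps_X ^ (n - j))"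
    by (simp only: prod.distrib)
  also have "(\<Prod>j<n. (fps_X :: int fps) ^ j) = fps_X ^ (n choose 2)"
    by (simp flip: sum_choose_two add: power_sum)
  also have "(\<Prod>j<n. 1 - (fps_X :: int fps) ^ (n - j)) = qpoch n"
    unfolding qpoch_def by (subst prod.nat_diff_reindex[symmetric]) (intro prod.cong, auto simp: Suc_diff_Suc)
  finally show ?thesis by simp
qed

lemma prod_X_power_above:
  "(\<Prod>j<n. fps_X ^ n - fps_X ^ (n + Suc j)) = fps_X ^ (n * n) * qpoch n"
proof -
  have "(\<Prod>j<n. fps_X ^ n - fps_X ^ (n + Suc j)) = (\<Prod>j<n. fps_X ^ n * (1 - (fps_X :: int fps) ^ Suc j))"
    by (intro prod.cong) (simp_all add: algebra_simps power_add)
  also have "\<dots> = (\<Prod>j<n. fps_X ^ n) * qpoch n"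
    unfolding qpoch_def by (simp only: prod.distrib)
  finally show ?thesis by (simp add: power_mult)
qed

text \<open>
  The derivative at \<open>w = 1\<close> of the \<open>q\<close>-binomial theorem for
  \<open>\<Prod>j\<le>2n. (q\<^sup>n - w q\<^sup>j)\<close>, whose factor \<open>j = n\<close> vanishes there.
\<close>

lemma jacobi_finite:
  "(\<Sum>l\<le>n. of_int ((-1) ^ l * (2 * int l + 1)) * fps_X ^ (Suc l choose 2)
      * qbinom (2 * n + 1) (n - l)) = qpoch n ^ 2"
proof -
  define N where "N = 2 * n + 1"
  define f where "f j = [:(fps_X :: int fps) ^ n, - (fps_X ^ j):]" for j :: nat
  define c where "c k = (-1) ^ k * qbinom N k * fps_X ^ ((k choose 2) + n * (N - k))" for k
  have N: "N = n + Suc n" by (simp add: N_def)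
  have poly_sum: "(\<Prod>j<N. f j) = (\<Sum>k\<le>N. monom (c k) k)"
  proof -
    have "(\<Prod>j<N. f j) = (\<Prod>j<N. [:fps_X ^ n:] + [:0, -1:] * [:fps_X ^ j:])"
      by (simp add: f_def)
    also have "\<dots> = (\<Sum>k\<le>N. [:qbinom N k * fps_X ^ (k choose 2):] * [:0, -1:] ^ k * [:fps_X ^ n:] ^ (N - k))"
      by (rule qbinomial_theorem)
    also have "\<dots> = (\<Sum>k\<le>N. monom (c k) k)"
    proof (intro sum.cong refl)
      fix k
      have 1: "[:0, -1 :: int fps:] ^ k = monom ((-1) ^ k) k"
        by (induction k) (simp_all add: monom_Suc monom_0 one_pCons minus_monom)
      have 2: "[:(fps_X :: int fps) ^ n:] ^ m = [:fps_X ^ (n * m):]" for m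
        by (induction m) (simp_all add: one_pCons power_add)
      show "[:qbinom N k * fps_X ^ (k choose 2):] * [:0, -1:] ^ k * [:fps_X ^ n:] ^ (N - k) = monom (c k) k"
        by (simp add: 1 2 c_def smult_monom power_add mult_ac)
    qed
    finally show ?thesis .
  qed
  \<comment> \<open>The n comes from the derivative of \<open>f n\<close>, the other two terms from
    the factors below and above it.\<close>
  define e where "e = n + (n choose 2) + n * n"
  have "poly (pderiv (\<Prod>j<N. f j)) 1 = - ((-1) ^ n * fps_X ^ e) * qpoch n ^ 2"
  proof -
    have "(\<Prod>j<N. f j) = f n * ((\<Prod>j<n. f j) * (\<Prod>j<n. f (n + Suc j)))"
      unfolding N prod_lessThan_add by (subst prod.lessThan_Suc_shift) (simp add: mult_ac)
    \<comment> \<open>As \<open>f n\<close> vanishes at 1, the product rule leaves only its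
      derivative -q^n times the other factors.\<close>
    then have "poly (pderiv (\<Prod>j<N. f j)) 1 =
        - (fps_X ^ n * (\<Prod>j<n. fps_X ^ n - fps_X ^ j) * (\<Prod>j<n. fps_X ^ n - fps_X ^ (n + Suc j)))"
      by (simp only: pderiv_mult) (simp add: f_def poly_prod pderiv_pCons)
    also have "\<dots> = - ((-1) ^ n * fps_X ^ e) * qpoch n ^ 2"
      by (simp only: prod_X_power_below prod_X_power_above) (simp add: e_def power_add power2_eq_square mult_ac)
    finally show ?thesis .
  qed
  moreover have "poly (pderiv (\<Prod>j<N. f j)) 1 = (\<Sum>k\<le>N. of_nat k * c k)"
  proof -
    have "pderiv (\<Sum>k\<le>n. monom (c k) k) = (\<Sum>k\<le>n. pderiv (monom (c k) k))" for n
      by (induction n) (simp_all add: pderiv_add)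
    then show ?thesis
      unfolding poly_sum by (simp add: pderiv_monom Polynomial.poly_sum poly_monom)
  qed
  moreover have "(\<Sum>k\<le>N. of_nat k * c k) =
      - ((-1) ^ n * fps_X ^ e) * (\<Sum>l\<le>n. of_int ((-1) ^ l * (2 * int l + 1)) * fps_X ^ (Suc l choose 2)
      * qbinom N (n - l))"
  proof -
    have "(\<Sum>k\<le>N. of_nat k * c k) = (\<Sum>k<Suc n + Suc n. of_nat k * c k)"
      by (intro sum.cong) (auto simp: N_def)
    also have "\<dots> = (\<Sum>k<Suc n. of_nat k * c k) + (\<Sum>l<Suc n. of_nat (Suc n + l) * c (Suc n + l))"
      by (rule sum_lessThan_add)
    \<comment> \<open>Reversal pairs k = n - l with k = n + 1 + l. Both carry the same power of q
      and the same Gaussian binomial with opposite signs, so the weights combine to (n - l) - (n + 1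
      + l) = -(2l + 1).\<close>
    also have "(\<Sum>k<Suc n. of_nat k * c k) = (\<Sum>l<Suc n. of_nat (n - l) * c (n - l))"
      by (subst sum.nat_diff_reindex[symmetric]) simp
    also have "\<dots> + (\<Sum>l<Suc n. of_nat (Suc n + l) * c (Suc n + l)) =
       (\<Sum>l\<le>n. of_nat (n - l) * c (n - l) + of_nat (Suc n + l) * c (Suc n + l))"
      by (simp add: sum.distrib lessThan_Suc_atMost)
    also have "\<dots> = (\<Sum>l\<le>n. - ((-1) ^ n * fps_X ^ e) *
      (of_int ((-1) ^ l * (2 * int l + 1)) * fps_X ^ (Suc l choose 2) * qbinom N (n - l)))"
    proof (intro sum.cong refl)
      fix l assume "l \<in> {..n}"
      then obtain m where n: "n = l + m" by (metis atMost_iff le_Suc_ex)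
      have "N = m + (Suc n + l)" by (simp add: N_def n)
      then have s: "qbinom N (Suc n + l) = qbinom N m" by (metis qbinom_sym)
      have e1: "(m choose 2) + n * (N - m) = e + (Suc l choose 2)"
      proof -
        \<comment> \<open>Doubling clears the halves in the binomials and leaves a polynomial
          identity in l and m.\<close>
        have "2 * (int (m choose 2) + int n * (2 * int l + int m + 1)) =
            2 * (int n + int (n choose 2) + int n * int n + int (Suc l choose 2))"
          unfolding distrib_left int_choose_two by (simp add: n algebra_simps)
        moreover have "int (N - m) = 2 * int l + int m + 1" by (simp add: N_def n)
        ultimately have "int ((m choose 2) + n * (N - m)) = int (e + (Suc l choose 2))"
          by (simp add: e_def)
        then show ?thesis by linarith
      qed
      have e2: "((Suc n + l) choose 2) + n * (N - (Suc n + l)) = e + (Suc l choose 2)"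
      proof -
        have "2 * (int ((Suc n + l) choose 2) + int n * int m) =
            2 * (int n + int (n choose 2) + int n * int n + int (Suc l choose 2))"
          unfolding distrib_left int_choose_two by (simp add: n algebra_simps)
        moreover have "N - (Suc n + l) = m" by (simp add: N_def n)
        ultimately have "int (((Suc n + l) choose 2) + n * (N - (Suc n + l))) = int (e + (Suc l choose 2))"
          by (simp add: e_def)
        then show ?thesis by linarith
      qed
      have m: "n - l = m" by (simp add: n)
      have sg: "(-1) ^ m = ((-1) ^ n * (-1) ^ l :: int fps)" "(-1) ^ (Suc n + l) = (- ((-1) ^ n * (-1) ^ l) :: int fps)"
        by (simp_all add: n power_add flip: power_mult_distrib)
      have "of_nat m * c m + of_nat (Suc n + l) * c (Suc n + l) =
         (of_nat m - of_nat (Suc n + l)) * ((-1) ^ n * (-1) ^ l * qbinom N m * fps_X ^ (e + (Suc l choose 2)))"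
        unfolding c_def e1 e2 s sg by (simp add: algebra_simps)
      also have "(of_nat m - of_nat (Suc n + l) :: int fps) = - of_int (2 * int l + 1)"
        by (simp add: n)
      also have "- of_int (2 * int l + 1) * ((-1) ^ n * (-1) ^ l * qbinom N m * fps_X ^ (e + (Suc l choose 2))) =
          - ((-1) ^ n * fps_X ^ e) * (of_int ((-1) ^ l * (2 * int l + 1)) * fps_X ^ (Suc l choose 2) * qbinom N m)"
        by (simp only: power_add of_int_mult of_int_power of_int_minus of_int_1 mult_minus_left mult_minus_right mult_ac)
      finally show "of_nat (n - l) * c (n - l) + of_nat (Suc n + l) * c (Suc n + l) =
          - ((-1) ^ n * fps_X ^ e) * (of_int ((-1) ^ l * (2 * int l + 1)) * fps_X ^ (Suc l choose 2) * qbinom N (n - l))"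
        unfolding m .
    qed
    also have "\<dots> = - ((-1) ^ n * fps_X ^ e) * (\<Sum>l\<le>n. of_int ((-1) ^ l * (2 * int l + 1)) * fps_X ^ (Suc l choose 2)
      * qbinom N (n - l))"
      by (rule sum_distrib_left[symmetric])
    finally show ?thesis .
  qed
  ultimately have *: "- ((-1) ^ n * fps_X ^ e) * qpoch n ^ 2 = - ((-1) ^ n * fps_X ^ e) *
      (\<Sum>l\<le>n. of_int ((-1) ^ l * (2 * int l + 1)) * fps_X ^ (Suc l choose 2) * qbinom N (n - l))"
    by simp
  have "- ((-1) ^ n * fps_X ^ e) \<noteq> (0 :: int fps)" by simp
  from mult_left_cancel[OF this, THEN iffD1, OF *] have "qpoch n ^ 2 = (\<Sum>l\<le>n. of_int ((-1) ^ l * (2 * int l + 1)) * fps_X ^ (Suc l choose 2) * qbinom N (n - l))"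
    .
  then show ?thesis unfolding N_def by (rule sym)
qed

text \<open>\<open>jacobi_finite\<close> is multiplied by E. The Gaussian binomial times E is 1
  modulo q^(n-l+1), and the factor q^(l(l+1)/2) supplies the missing q^l.\<close>

lemma jacobi_dvd:
  "fps_X ^ Suc n dvd (\<Sum>l\<le>n. of_int ((-1) ^ l * (2 * int l + 1)) * fps_X ^ (Suc l choose 2)) - euler ^ 3"
proof -
  define a where "a l = (of_int ((-1) ^ l * (2 * int l + 1)) :: int fps)" for l
  have summand: "fps_X ^ Suc n dvd fps_X ^ (Suc l choose 2) * (qbinom (2 * n + 1) (n - l) * euler) - fps_X ^ (Suc l choose 2)"
    if "l \<le> n" for l
  proof -
    define m where "m = n - l"
    define b where "b = qbinom (2 * n + 1) m"
    have "2 * n + 1 = m + (n + 1 + l)" using that by (simp add: m_def)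
    then have b: "b * qpoch m * qpoch (n + 1 + l) = qpoch (2 * n + 1)"
      unfolding b_def by (metis qbinom_qpoch)
    have 1: "fps_X ^ Suc m dvd euler - qpoch k" if "m \<le> k" for k
      using euler_dvd_diff[of k] that by (meson dvd_trans le_imp_power_dvd Suc_le_mono)
    have 2: "fps_X ^ Suc m dvd qpoch k - euler" if "m \<le> k" for k
      using 1[OF that] by (rule dvd_diff_sym)
    \<comment> \<open>Modulo q^(m+1) all three finite products in \<open>b\<close> become E; one E
      is then cancelled.\<close>
    have "fps_X ^ Suc m dvd b * euler * euler - b * qpoch m * qpoch (n + 1 + l)"
      by (intro dvd_diff_mult 1) (auto simp: m_def)
    then have "fps_X ^ Suc m dvd b * euler * euler - euler"
      unfolding b by (rule dvd_diff_trans) (rule 2, simp add: m_def)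
    then have "fps_X ^ Suc m dvd euler * (b * euler - 1)"
      by (simp add: algebra_simps)
    then have "fps_X ^ Suc m dvd euler_inv * (euler * (b * euler - 1))"
      by (rule dvd_mult)
    then have "fps_X ^ Suc m dvd b * euler - 1"
      by (simp only: euler_inv mult_1 flip: mult.assoc)
    then have "fps_X ^ l * fps_X ^ Suc m dvd fps_X ^ (Suc l choose 2) * (b * euler - 1)"
      by (intro mult_dvd_mono le_imp_power_dvd) (auto simp: numeral_2_eq_2)
    moreover have "fps_X ^ l * fps_X ^ Suc m = (fps_X ^ Suc n :: int fps)"
      using that by (simp add: m_def flip: power_add)
    ultimately have "fps_X ^ Suc n dvd fps_X ^ (Suc l choose 2) * (b * euler - 1)"
      by (simp only:)
    then show ?thesis by (simp only: b_def m_def right_diff_distrib mult_1_right)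
  qed
  have "fps_X ^ Suc n dvd (\<Sum>l\<le>n. a l * (fps_X ^ (Suc l choose 2) * (qbinom (2 * n + 1) (n - l) * euler) - fps_X ^ (Suc l choose 2)))"
    by (intro dvd_sum dvd_mult summand) auto
  also have "(\<Sum>l\<le>n. a l * (fps_X ^ (Suc l choose 2) * (qbinom (2 * n + 1) (n - l) * euler) - fps_X ^ (Suc l choose 2)))
     = (\<Sum>l\<le>n. a l * fps_X ^ (Suc l choose 2) * qbinom (2 * n + 1) (n - l)) * euler - (\<Sum>l\<le>n. a l * fps_X ^ (Suc l choose 2))"
    by (simp add: right_diff_distrib sum_subtractf sum_distrib_right mult.assoc)
  also have "\<dots> = qpoch n ^ 2 * euler - (\<Sum>l\<le>n. a l * fps_X ^ (Suc l choose 2))"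
    unfolding a_def jacobi_finite ..
  finally have "fps_X ^ Suc n dvd (\<Sum>l\<le>n. a l * fps_X ^ (Suc l choose 2)) - qpoch n ^ 2 * euler"
    by (rule dvd_diff_sym)
  moreover have "fps_X ^ Suc n dvd qpoch n ^ 2 * euler - euler ^ 2 * euler"
    using euler_dvd_diff[of n] by (intro dvd_diff_mult dvd_diff_power) (auto intro: dvd_diff_sym)
  ultimately have "fps_X ^ Suc n dvd (\<Sum>l\<le>n. a l * fps_X ^ (Suc l choose 2)) - euler ^ 2 * euler"
    by (rule dvd_diff_trans)
  also have "euler ^ 2 * euler = euler ^ 3" by (simp add: power2_eq_square power3_eq_cube)
  finally show ?thesis unfolding a_def .
qed

subsection \<open>The 3-dissection\<close>

text \<open>\<open>sec3 0\<close> is the operator U_3 of modular form theory; \<open>dil3\<close>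
  below is its right inverse V_3.\<close>

definition sec3 :: "nat \<Rightarrow> int fps \<Rightarrow> int fps" where
  "sec3 r f = Abs_fps (\<lambda>n. f $ (3 * n + r))"

definition dil3 :: "int fps \<Rightarrow> int fps" where
  "dil3 f = f oo fps_X ^ 3"

lemma sec3_nth [simp]: "sec3 r f $ n = f $ (3 * n + r)"
  by (simp add: sec3_def)

lemma dil3_nth: "dil3 f $ n = (if 3 dvd n then f $ (n div 3) else 0)"
  by (simp add: dil3_def fps_nth_compose_X_power)

lemma dil3_mult: "dil3 (f * g) = dil3 f * dil3 g"
  by (simp add: dil3_def fps_compose_mult_distrib fps_nth_power_0)

lemma dil3_power: "dil3 (f ^ n) = dil3 f ^ n"
  by (simp add: dil3_def fps_compose_power fps_nth_power_0)

lemma dil3_diff: "dil3 (f - g) = dil3 f - dil3 g"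
  by (simp add: dil3_def fps_compose_sub_distrib)

lemma dil3_1 [simp]: "dil3 1 = 1"
  by (simp add: dil3_def)

lemma dil3_X: "dil3 fps_X = fps_X ^ 3"
  by (simp add: dil3_def fps_X_fps_compose_startby0 fps_nth_power_0)

lemma dil3_X_power: "dil3 (fps_X ^ n) = fps_X ^ (3 * n)"
  by (simp add: dil3_power dil3_X power_mult)

lemma dil3_dvd: "fps_X ^ n dvd f - g \<Longrightarrow> fps_X ^ n dvd dil3 f - dil3 g"
  unfolding fps_X_power_dvd_iff by (auto simp: dil3_nth intro: le_less_trans[OF div_le_dividend])

lemma sec3_add: "sec3 r (f + g) = sec3 r f + sec3 r g"
  by (simp add: fps_eq_iff)

lemma sec3_0 [simp]: "sec3 r 0 = 0"
  by (simp add: fps_eq_iff)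

lemma sec3_sum: "sec3 r (\<Sum>i\<in>A. f i) = (\<Sum>i\<in>A. sec3 r (f i))"
  by (induction A rule: infinite_finite_induct) (simp_all add: sec3_add)

text \<open>Only indices 3j contribute to the Cauchy product, and r < 3 makes 3j \<le> 3n + r
  equivalent to j \<le> n.\<close>

lemma sec3_dil3_mult: "r < 3 \<Longrightarrow> sec3 r (dil3 f * g) = f * sec3 r g"
proof (rule fps_ext)
  fix n assume "r < 3"
  have "sec3 r (dil3 f * g) $ n = (\<Sum>i\<le>3 * n + r. dil3 f $ i * g $ (3 * n + r - i))"
    by (simp add: fps_mult_nth atLeast0AtMost)
  also have "\<dots> = (\<Sum>i\<in>(\<lambda>j. 3 * j) ` {..n}. dil3 f $ i * g $ (3 * n + r - i))"
  proof (intro sum.mono_neutral_right ballI)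
    show "(\<lambda>j. 3 * j) ` {..n} \<subseteq> {..3 * n + r}" by auto
    fix i assume i: "i \<in> {..3 * n + r} - (\<lambda>j. 3 * j) ` {..n}"
    have "\<not> 3 dvd i"
    proof
      assume "3 dvd i"
      then obtain j where "i = 3 * j" by (rule dvdE)
      with i \<open>r < 3\<close> show False by auto
    qed
    then show "dil3 f $ i * g $ (3 * n + r - i) = 0" by (simp add: dil3_nth)
  qed simp
  also have "\<dots> = (\<Sum>j\<le>n. f $ j * g $ (3 * (n - j) + r))"
    by (subst sum.reindex) (auto intro!: sum.cong simp: inj_on_def dil3_nth diff_mult_distrib2)
  also have "\<dots> = (f * sec3 r g) $ n"
    by (simp add: fps_mult_nth atLeast0AtMost)
  finally show "sec3 r (dil3 f * g) $ n = (f * sec3 r g) $ n" .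
qed

lemma dil3_of_int [simp]: "dil3 (of_int c) = of_int c"
  by (auto simp: fps_eq_iff dil3_nth simp flip: fps_of_int)

lemma sec3_of_int_mult: "sec3 r (of_int c * f) = of_int c * sec3 r f"
  by (simp add: fps_eq_iff flip: fps_of_int)

lemma sec3_X_mult: "sec3 0 (fps_X * f) = fps_X * sec3 2 f"
  "sec3 1 (fps_X * f) = sec3 0 f" "sec3 2 (fps_X * f) = sec3 1 f"
proof -
  show "sec3 0 (fps_X * f) = fps_X * sec3 2 f"
    by (rule fps_ext) (auto simp: algebra_simps intro!: arg_cong[where f = "fps_nth f"])
qed (simp_all add: fps_eq_iff)

lemma sec3_dil3 [simp]: "sec3 0 (dil3 f) = f" "sec3 1 (dil3 f) = 0" "sec3 2 (dil3 f) = 0"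
proof -
  have "\<not> 3 dvd 3 * n + 1" "\<not> 3 dvd 3 * n + 2" for n :: nat by presburger+
  then show "sec3 0 (dil3 f) = f" "sec3 1 (dil3 f) = 0" "sec3 2 (dil3 f) = 0"
    by (auto simp: fps_eq_iff dil3_nth)
qed

lemma sec3_X_power: "sec3 0 (fps_X ^ n) = (if 3 dvd n then fps_X ^ (n div 3) else 0)"
  by (auto simp: fps_eq_iff elim!: dvdE)

lemma dissect3:
  "f = dil3 (sec3 0 f) + fps_X * dil3 (sec3 1 f) + fps_X * (fps_X * dil3 (sec3 2 f))"
proof (rule fps_ext)
  fix n
  have "\<exists>m. n = 3 * m \<or> n = Suc (3 * m) \<or> n = Suc (Suc (3 * m))" by presburger
  then obtain m where "n = 3 * m \<or> n = Suc (3 * m) \<or> n = Suc (Suc (3 * m))"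
    by blast
  moreover have "\<not> 3 dvd Suc (3 * n)" "\<not> 3 dvd Suc (Suc (3 * n))" for n by presburger+
  moreover have "3 dvd 3 * m - Suc 0 \<longleftrightarrow> m = 0" "3 dvd 3 * m - Suc (Suc 0) \<longleftrightarrow> m = 0" by presburger+
  ultimately show "f $ n = (dil3 (sec3 0 f) + fps_X * dil3 (sec3 1 f) + fps_X * (fps_X * dil3 (sec3 2 f))) $ n"
    by (auto simp: dil3_nth)
qed

section \<open>Multiplying dissections; the cubic norm\<close>

lemma sec3_mult:
  "sec3 0 (f * g) = sec3 0 f * sec3 0 g + fps_X * (sec3 1 f * sec3 2 g + sec3 2 f * sec3 1 g)"
  "sec3 1 (f * g) = sec3 0 f * sec3 1 g + sec3 1 f * sec3 0 g + fps_X * (sec3 2 f * sec3 2 g)"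
  "sec3 2 (f * g) = sec3 0 f * sec3 2 g + sec3 1 f * sec3 1 g + sec3 2 f * sec3 0 g"
proof -
  have *: "f * g = dil3 (sec3 0 f) * g + fps_X * (dil3 (sec3 1 f) * g) + fps_X * (fps_X * (dil3 (sec3 2 f) * g))"
    by (subst dissect3[of f]) (simp add: algebra_simps)
  have sd: "sec3 0 (dil3 f * g) = f * sec3 0 g" "sec3 1 (dil3 f * g) = f * sec3 1 g"
    "sec3 2 (dil3 f * g) = f * sec3 2 g" for f g
    by (simp_all add: sec3_dil3_mult)
  show "sec3 0 (f * g) = sec3 0 f * sec3 0 g + fps_X * (sec3 1 f * sec3 2 g + sec3 2 f * sec3 1 g)"
    "sec3 1 (f * g) = sec3 0 f * sec3 1 g + sec3 1 f * sec3 0 g + fps_X * (sec3 2 f * sec3 2 g)"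
    "sec3 2 (f * g) = sec3 0 f * sec3 2 g + sec3 1 f * sec3 1 g + sec3 2 f * sec3 0 g"
    unfolding * sec3_add sec3_X_mult sd by (simp_all add: algebra_simps)
qed

text \<open>The product of \<open>f(\<omega>\<^sup>j q\<^bsup>1/3\<^esup>)\<close> over the three cube roots of unity \<open>\<omega>\<^sup>j\<close>.\<close>

definition norm3 :: "int fps \<Rightarrow> int fps" where
  "norm3 f = sec3 0 f ^ 3 + fps_X * sec3 1 f ^ 3 + fps_X ^ 2 * sec3 2 f ^ 3
     - 3 * fps_X * sec3 0 f * sec3 1 f * sec3 2 f"

text \<open>With t^3 = q, this is the norm form of x_0 + x_1 t + x_2 t^2, and
  \<open>sec3_mult\<close> multiplies such elements; what remains is a polynomial identity in the
  sections.\<close>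

lemma norm3_mult: "norm3 (f * g) = norm3 f * norm3 g"
  unfolding norm3_def sec3_mult by algebra

lemma norm3_power: "norm3 (f ^ n) = norm3 f ^ n"
proof (induction n)
  case 0
  show ?case using sec3_dil3[of 1] by (simp add: norm3_def)
qed (simp add: norm3_mult)

lemma sec3_dvd:
  assumes "fps_X ^ (3 * n) dvd f - g" "r < 3"
  shows "fps_X ^ n dvd sec3 r f - sec3 r g"
  using assms unfolding fps_X_power_dvd_iff by auto

text \<open>Continuity of the norm; passing to sections divides the q-adic precision by 3.\<close>

lemma norm3_dvd:
  assumes "fps_X ^ (3 * n) dvd f - g"
  shows "fps_X ^ n dvd norm3 f - norm3 g"
proof -
  have s: "fps_X ^ n dvd sec3 r f - sec3 r g" if "r < 3" for r
    using assms that by (rule sec3_dvd)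
  have add: "m dvd (a + c) - (b + d)" if "m dvd a - b" "m dvd c - d" for a b c d m :: "int fps"
    using dvd_add[OF that] by (simp add: algebra_simps)
  have diff: "m dvd (a - c) - (b - d)" if "m dvd a - b" "m dvd c - d" for a b c d m :: "int fps"
    using dvd_diff[OF that] by (simp add: algebra_simps)
  show ?thesis
    unfolding norm3_def
    by (intro add diff dvd_diff_mult dvd_diff_power s) auto
qed

text \<open>For m prime to 3 the conjugates of 1 - q^m are the three linear factors of 1 - q^m in
  q^(m/3); for m = 3k all of them equal 1 - q^k.\<close>

lemma norm3_one_minus_X_power:
  "norm3 (1 - fps_X ^ (3 * k)) = (1 - fps_X ^ k) ^ 3"
  "norm3 (1 - fps_X ^ (3 * k + 1)) = 1 - fps_X ^ (3 * k + 1)"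
  "norm3 (1 - fps_X ^ (3 * k + 2)) = 1 - fps_X ^ (3 * k + 2)"
proof -
  have sub: "sec3 r (f - g) = sec3 r f - sec3 r g" for r f g by (simp add: fps_eq_iff)
  have one: "sec3 0 1 = 1" "sec3 1 1 = 0" "sec3 2 1 = 0" using sec3_dil3[of 1] by simp_all
  have 0: "1 - fps_X ^ (3 * k) = dil3 (1 - fps_X ^ k)"
    by (simp add: dil3_diff dil3_X_power)
  have p: "(fps_X :: int fps) ^ (3 * k + 1) = fps_X * dil3 (fps_X ^ k)"
     "(fps_X :: int fps) ^ (3 * k + 2) = fps_X * (fps_X * dil3 (fps_X ^ k))"
    by (simp_all add: dil3_X_power)
  show "norm3 (1 - fps_X ^ (3 * k)) = (1 - fps_X ^ k) ^ 3"
    unfolding 0 norm3_def by (simp del: One_nat_def)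
  have kk: "((fps_X :: int fps) ^ k) ^ 3 = fps_X ^ (3 * k)"
    using power_mult[of "fps_X :: int fps" k 3] by (simp only: mult.commute)
  show "norm3 (1 - fps_X ^ (3 * k + 1)) = 1 - fps_X ^ (3 * k + 1)"
    unfolding norm3_def sub one unfolding p sec3_X_mult sec3_dil3
    by (simp add: dil3_X_power kk power2_eq_square mult.assoc)
  show "norm3 (1 - fps_X ^ (3 * k + 2)) = 1 - fps_X ^ (3 * k + 2)"
    unfolding norm3_def sub one unfolding p sec3_X_mult sec3_dil3
    by (simp add: dil3_X_power kk power2_eq_square mult.assoc)
qed

text \<open>Length 3n adds a full residue system modulo 3 per induction step. The dilated factor
  restores the 1 - q^(3k) that the norm lacks.\<close>

lemma norm3_qpoch: "norm3 (qpoch (3 * n)) * dil3 (qpoch n) = qpoch (3 * n) * qpoch n ^ 3"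
proof (induction n)
  case 0
  show ?case using norm3_power[of 1 0] by simp
next
  case (Suc n)
  define x where "x = (fps_X :: int fps)"
  have 1: "qpoch (3 * Suc n) = qpoch (3 * n) * (1 - x ^ (3 * n + 1)) * (1 - x ^ (3 * n + 2)) * (1 - x ^ (3 * Suc n))"
    by (simp add: x_def qpoch_Suc numeral_3_eq_3 numeral_2_eq_2)
  have 2: "dil3 (qpoch (Suc n)) = dil3 (qpoch n) * (1 - x ^ (3 * Suc n))"
    by (simp only: qpoch_Suc dil3_mult dil3_diff dil3_1 dil3_X_power x_def)
  have 3: "norm3 (qpoch (3 * Suc n)) = norm3 (qpoch (3 * n)) * (1 - x ^ (3 * n + 1)) * (1 - x ^ (3 * n + 2)) * (1 - x ^ Suc n) ^ 3"
    unfolding 1 unfolding x_def norm3_mult norm3_one_minus_X_power ..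
  have 4: "qpoch (Suc n) = qpoch n * (1 - x ^ Suc n)" by (simp only: qpoch_Suc x_def)
  have "norm3 (qpoch (3 * Suc n)) * dil3 (qpoch (Suc n)) = (norm3 (qpoch (3 * n)) * dil3 (qpoch n)) *
      ((1 - x ^ (3 * n + 1)) * (1 - x ^ (3 * n + 2)) * (1 - x ^ (3 * Suc n)) * (1 - x ^ Suc n) ^ 3)"
    unfolding 3 2 by (simp only: mult_ac)
  also have "\<dots> = qpoch (3 * Suc n) * qpoch (Suc n) ^ 3"
    unfolding Suc.IH 1 4 by (simp only: mult_ac power_mult_distrib)
  finally show ?case .
qed

lemma norm3_euler: "norm3 euler * dil3 euler = euler ^ 4"
proof (rule fps_eqI_dvd)
  fix n
  have 1: "fps_X ^ Suc n dvd euler - qpoch m" if "m \<ge> n" for m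
    using euler_dvd_diff[of m] by (rule dvd_trans[rotated]) (use that in \<open>intro le_imp_power_dvd; simp\<close>)
  have "fps_X ^ (3 * Suc n) dvd euler - qpoch (3 * Suc n)"
    using euler_dvd_diff[of "3 * Suc n"] by (rule dvd_trans[rotated]) (intro le_imp_power_dvd; simp)
  then have "fps_X ^ Suc n dvd norm3 euler - norm3 (qpoch (3 * Suc n))"
    by (rule norm3_dvd)
  then have "fps_X ^ Suc n dvd norm3 euler * dil3 euler - norm3 (qpoch (3 * Suc n)) * dil3 (qpoch (Suc n))"
    by (intro dvd_diff_mult dil3_dvd 1) auto
  moreover have "fps_X ^ Suc n dvd qpoch (3 * Suc n) * qpoch (Suc n) ^ 3 - euler * euler ^ 3"
    by (intro dvd_diff_mult dvd_diff_power dvd_diff_sym[OF 1]) auto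
  ultimately have "fps_X ^ Suc n dvd norm3 euler * dil3 euler - euler * euler ^ 3"
    unfolding norm3_qpoch by (rule dvd_diff_trans)
  then show "fps_X ^ Suc n dvd norm3 euler * dil3 euler - euler ^ 4"
    by (simp add: power_Suc[symmetric] del: power_Suc)
qed

section \<open>The dissection of E^3 through triangular numbers modulo 3\<close>

lemma euler_cube_nth:
  "(euler ^ 3) $ n = (\<Sum>l\<le>n. if n = Suc l choose 2 then (-1) ^ l * (2 * int l + 1) else 0)"
proof -
  have "(euler ^ 3) $ n = (\<Sum>l\<le>n. of_int ((-1) ^ l * (2 * int l + 1)) * fps_X ^ (Suc l choose 2)) $ n"
    using jacobi_dvd[of n] unfolding fps_X_power_dvd_iff by auto
  also have "\<dots> = (\<Sum>l\<le>n. if n = Suc l choose 2 then (-1) ^ l * (2 * int l + 1) else 0)"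
    unfolding fps_sum_nth by (intro sum.cong) (simp_all flip: fps_of_int)
  finally show ?thesis .
qed

lemma Suc_choose_two: "2 * (Suc l choose 2) = l * Suc l"
  by (induction l) (simp_all add: numeral_2_eq_2 algebra_simps)

lemma euler_cube_nth_triangular: "(euler ^ 3) $ (Suc l choose 2) = (-1) ^ l * (2 * int l + 1)"
proof -
  have inj: "l = k" if "Suc l choose 2 = Suc k choose 2" for k
  proof -
    have "l * Suc l = k * Suc k" using that by (metis Suc_choose_two)
    then have "\<not> l < k" "\<not> k < l"
      using mult_strict_mono[of l k "Suc l" "Suc k"] mult_strict_mono[of k l "Suc k" "Suc l"] by auto
    then show ?thesis by simp
  qed
  have "l \<le> Suc l choose 2" by (simp add: numeral_2_eq_2)
  moreover have "(euler ^ 3) $ (Suc l choose 2) = (\<Sum>k\<le>Suc l choose 2. if l = k then (-1) ^ k * (2 * int k + 1) else 0)"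
    unfolding euler_cube_nth by (intro sum.cong) (auto dest: inj)
  ultimately show ?thesis by simp
qed

lemma euler_cube_nth_eq_0: "(\<And>l. n \<noteq> Suc l choose 2) \<Longrightarrow> (euler ^ 3) $ n = 0"
  unfolding euler_cube_nth by (intro sum.neutral) auto

text \<open>With T_l = l(l+1)/2, T_l is 0 modulo 3 unless l = 3k + 1, where T_l = 9 T_k + 1 and the
  coefficient is (-1)^(3k+1) (6k + 3) = -3 (-1)^k (2k + 1).\<close>

lemma sec3_euler_cube: "sec3 1 (euler ^ 3) = - 3 * dil3 (euler ^ 3)" "sec3 2 (euler ^ 3) = 0"
proof -
  have tri: "(\<exists>k. l = 3 * k + 1 \<and> Suc l choose 2 = 9 * (Suc k choose 2) + 1) \<or> 3 dvd Suc l choose 2" for l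
  proof -
    have dvd3: "3 dvd 2 * t \<Longrightarrow> 3 dvd t" for t :: nat by presburger
    have "\<exists>k. l = 3 * k \<or> l = 3 * k + 1 \<or> l = 3 * k + 2" by presburger
    then consider k where "l = 3 * k" | k where "l = 3 * k + 1" | k where "l = 3 * k + 2"
      by blast
    then show ?thesis
    proof cases
      case 1
      have "2 * (Suc l choose 2) = 3 * (k * Suc l)" using Suc_choose_two[of l] 1 by simp
      then have "3 dvd 2 * (Suc l choose 2)" by simp
      then show ?thesis by (blast dest: dvd3)
    next
      case 2
      have "2 * (Suc l choose 2) = 2 * (9 * (Suc k choose 2) + 1)"
        using Suc_choose_two[of l] Suc_choose_two[of k] 2 by (simp add: algebra_simps)
      then show ?thesis using 2 by auto
    next
      case 3
      have "2 * (Suc l choose 2) = 3 * (l * Suc k)" using Suc_choose_two[of l] 3 by simp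
      then have "3 dvd 2 * (Suc l choose 2)" by simp
      then show ?thesis by (blast dest: dvd3)
    qed
  qed
  have aux: "3 * n + 2 \<noteq> 9 * c + 1" "\<not> 3 dvd 3 * n + 2" "\<not> 3 dvd 3 * n + 1"
    "3 * n + 1 = 9 * c + 1 \<Longrightarrow> n = 3 * c" for n c :: nat
    by presburger+
  show "sec3 2 (euler ^ 3) = 0"
  proof (rule fps_ext)
    fix n
    have "(euler ^ 3) $ (3 * n + 2) = 0"
    proof (rule euler_cube_nth_eq_0)
      fix l show "3 * n + 2 \<noteq> Suc l choose 2"
        using tri[of l] aux(1)[of n] aux(2)[of n] by metis
    qed
    then show "sec3 2 (euler ^ 3) $ n = 0 $ n" by simp
  qed
  show "sec3 1 (euler ^ 3) = - 3 * dil3 (euler ^ 3)"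
  proof (rule fps_ext)
    fix n
    have neg3: "(- 3 * f) $ n = - 3 * f $ n" for f :: "int fps"
      by (metis fps_mult_left_const_nth numeral_fps_const fps_const_neg)
    have "(euler ^ 3) $ (3 * n + 1) = - 3 * (if 3 dvd n then (euler ^ 3) $ (n div 3) else 0)"
    proof (cases "\<exists>k. n = 3 * (Suc k choose 2)")
      case True
      then obtain k where n: "n = 3 * (Suc k choose 2)" by blast
      have "2 * (Suc (3 * k + 1) choose 2) = 2 * (3 * n + 1)"
        unfolding n Suc_choose_two using Suc_choose_two[of k] by (simp add: algebra_simps)
      then have "3 * n + 1 = Suc (3 * k + 1) choose 2" by simp
      then have "(euler ^ 3) $ (3 * n + 1) = (-1) ^ (3 * k + 1) * (2 * int (3 * k + 1) + 1)"
        by (simp only: euler_cube_nth_triangular)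
      moreover have "(euler ^ 3) $ (n div 3) = (-1) ^ k * (2 * int k + 1)"
        by (simp add: n euler_cube_nth_triangular)
      moreover have "(-1 :: int) ^ (3 * k + 1) = - ((-1) ^ k)"
        by (simp add: power_mult)
      ultimately show ?thesis by (simp add: n algebra_simps)
    next
      case False
      have "(euler ^ 3) $ (3 * n + 1) = 0"
      proof (rule euler_cube_nth_eq_0)
        fix l show "3 * n + 1 \<noteq> Suc l choose 2"
        proof
          assume *: "3 * n + 1 = Suc l choose 2"
          from tri[of l] show False
          proof
            assume "3 dvd Suc l choose 2"
            then show False using aux(3)[of n] * by metis
          next
            assume "\<exists>k. l = 3 * k + 1 \<and> Suc l choose 2 = 9 * (Suc k choose 2) + 1"
            then obtain k where "3 * n + 1 = 9 * (Suc k choose 2) + 1" using * by metis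
            then show False using aux(4) False by blast
          qed
        qed
      qed
      moreover have "(euler ^ 3) $ (n div 3) = 0" if "3 dvd n"
        by (rule euler_cube_nth_eq_0) (use that False in auto)
      ultimately show ?thesis by simp
    qed
    then show "sec3 1 (euler ^ 3) $ n = (- 3 * dil3 (euler ^ 3)) $ n"
      unfolding neg3 by (simp add: dil3_nth)
  qed
qed

subsection \<open>The Hauptmodul of level 3\<close>

lemma qpoch_power6_mult_p13_factor: "qpoch n ^ 6 * (\<Prod>k<n. p13_factor (Suc k)) = 1"
proof (induction n)
  case (Suc n)
  have "qpoch (Suc n) ^ 6 * (\<Prod>k<Suc n. p13_factor (Suc k)) =
      (qpoch n ^ 6 * (\<Prod>k<n. p13_factor (Suc k))) * ((1 - fps_X ^ Suc n) ^ 6 * p13_factor (Suc n))"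
    by (simp only: qpoch_Suc power_mult_distrib prod.lessThan_Suc mult_ac)
  also have "\<dots> = 1" unfolding Suc.IH using p13_factor_inverse[of "Suc n"] by simp
  finally show ?case .
qed simp

lemma euler_power_mult_inv: "euler ^ n * euler_inv ^ n = 1"
  by (metis euler_inv mult.commute power_mult_distrib power_one)

lemma Abs_fps_p13: "Abs_fps p13 = euler_inv ^ 6"
proof -
  have "euler ^ 6 * Abs_fps p13 = 1"
  proof (rule fps_eqI_dvd)
    fix n
    define f where "f M = (\<Prod>k\<le>M. p13_factor (Suc k))" for M
    have "f \<longlonglongrightarrow> Abs_fps p13"
      unfolding f_def using p13_has_prod by (rule has_prod_imp_tendsto)
    then have "\<forall>\<^sub>F M in sequentially. \<forall>k\<in>{..n}. f M $ k = Abs_fps p13 $ k"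
      unfolding tendsto_fps_iff by (intro eventually_ball_finite) auto
    then obtain M0 where M0: "\<And>M k. M \<ge> M0 \<Longrightarrow> k \<le> n \<Longrightarrow> f M $ k = Abs_fps p13 $ k"
      unfolding eventually_sequentially by auto
    \<comment> \<open>Beyond M0 the coefficients up to n have stabilised; beyond n the finite Euler
      product agrees with E.\<close>
    define M where "M = max M0 n"
    have 1: "fps_X ^ Suc n dvd Abs_fps p13 - f M"
      unfolding fps_X_power_dvd_iff using M0[of M] by (auto simp: M_def)
    have "fps_X ^ Suc n dvd euler - qpoch (Suc M)"
      using euler_dvd_diff[of "Suc M"]
      by (rule dvd_trans[rotated]) (intro le_imp_power_dvd, simp add: M_def)
    then have "fps_X ^ Suc n dvd euler ^ 6 * Abs_fps p13 - qpoch (Suc M) ^ 6 * f M"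
      by (intro dvd_diff_mult dvd_diff_power 1)
    then show "fps_X ^ Suc n dvd euler ^ 6 * Abs_fps p13 - 1"
      using qpoch_power6_mult_p13_factor[of "Suc M"] by (simp add: f_def lessThan_Suc_atMost)
  qed
  then have "euler ^ 6 * Abs_fps p13 = euler ^ 6 * euler_inv ^ 6"
    by (simp only: euler_power_mult_inv)
  moreover have "euler ^ 6 \<noteq> 0" using euler_power_mult_inv[of 6] by force
  ultimately show ?thesis by simp
qed

definition euler3 :: "int fps" where "euler3 = dil3 euler"

definition euler3_inv :: "int fps" where "euler3_inv = dil3 euler_inv"

lemma euler3_power_mult_inv: "euler3 ^ n * euler3_inv ^ n = 1"
  by (simp add: euler3_def euler3_inv_def euler_power_mult_inv flip: dil3_power dil3_mult)

definition jac0 :: "int fps" where "jac0 = sec3 0 (euler ^ 3)"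

text \<open>27 times the Hauptmodul (eta(3z)/eta(z))^12 of Gamma_0(3), scaled so that 1 +
  \<open>tau\<close> appears in \<open>jac0_cube\<close>.\<close>

definition tau :: "int fps" where
  "tau = 27 * (fps_X * euler3 ^ 12 * euler_inv ^ 12)"

lemma tau_nonzero [simp]: "tau \<noteq> 0"
proof -
  have "euler_inv \<noteq> 0" "euler3 \<noteq> 0"
    using euler_power_mult_inv[of 1] euler3_power_mult_inv[of 1] by auto
  then show ?thesis by (simp add: tau_def)
qed

text \<open>Two evaluations of the norm of E^3: from its sections, of which the last is zero, and as
  the cube of the norm E^4 / E(q^3) of E.\<close>

lemma jac0_cube_diff: "jac0 ^ 3 - 27 * fps_X * euler3 ^ 9 = euler ^ 12 * euler3_inv ^ 3"
proof -
  have "norm3 euler * euler3 = euler ^ 4"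
    unfolding euler3_def by (rule norm3_euler)
  then have "norm3 euler * (euler3 ^ 1 * euler3_inv ^ 1) = euler ^ 4 * euler3_inv"
    by (simp flip: mult.assoc)
  then have "norm3 euler = euler ^ 4 * euler3_inv"
    by (simp only: euler3_power_mult_inv mult_1_right)
  then have "norm3 (euler ^ 3) = (euler ^ 4 * euler3_inv) ^ 3"
    by (simp only: norm3_power)
  moreover have "norm3 (euler ^ 3) = jac0 ^ 3 + fps_X * (- 3 * euler3 ^ 3) ^ 3"
    unfolding norm3_def sec3_euler_cube by (simp add: jac0_def euler3_def dil3_power)
  moreover have "fps_X * (- 3 * euler3 ^ 3) ^ 3 = - (27 * fps_X * euler3 ^ 9)"
    by (simp add: power_mult_distrib mult_ac flip: power_mult)
  ultimately have "jac0 ^ 3 - 27 * fps_X * euler3 ^ 9 = (euler ^ 4 * euler3_inv) ^ 3"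
    by (simp only: diff_conv_add_uminus)
  then show ?thesis by (simp add: power_mult_distrib flip: power_mult)
qed

lemma jac0_cube: "jac0 ^ 3 = euler ^ 12 * euler3_inv ^ 3 * (1 + tau)"
proof -
  have "euler ^ 12 * euler3_inv ^ 3 * tau =
      27 * fps_X * euler3 ^ 9 * (euler ^ 12 * euler_inv ^ 12) * (euler3 ^ 3 * euler3_inv ^ 3)"
    using power_add[of euler3 9 3] by (simp add: tau_def mult_ac)
  then show ?thesis
    using jac0_cube_diff by (simp add: euler_power_mult_inv euler3_power_mult_inv algebra_simps)
qed

section \<open>Rationalising the denominator E^3\<close>

definition jac1 :: "int fps" where
  "jac1 = fps_X * dil3 (euler3 ^ 3)"

text \<open>The cofactor of \<open>A - z\<close> in \<open>A\<^sup>3 - z\<^sup>3\<close>, where \<open>z = 3 q E(q\<^sup>9)\<^sup>3\<close>.\<close>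

definition adj :: "int fps" where
  "adj = dil3 jac0 ^ 2 + dil3 jac0 * (3 * jac1) + (3 * jac1) ^ 2"

lemma dil3_numeral [simp]: "dil3 (numeral k) = numeral k"
  using dil3_of_int[of "numeral k"] by simp

lemma sec3_numeral_mult: "sec3 r (numeral k * f) = numeral k * sec3 r f"
  using sec3_of_int_mult[of r "numeral k"] by simp

lemma euler_cube: "euler ^ 3 = dil3 jac0 - 3 * jac1"
proof -
  have "dil3 0 = 0" by (simp add: dil3_def)
  moreover have "dil3 (- 3 * f) = - 3 * dil3 f" for f
    using dil3_mult[of "-3" f] dil3_of_int[of "-3"] by simp
  ultimately have "euler ^ 3 = dil3 (sec3 0 (euler ^ 3)) + fps_X * (- 3 * dil3 (dil3 (euler ^ 3)))"
    using dissect3[of "euler ^ 3"] unfolding sec3_euler_cube by (simp only: mult_zero_right add_0_right)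
  then show ?thesis
    by (simp add: jac0_def jac1_def euler3_def dil3_power mult.left_commute)
qed

text \<open>By \<open>jac0_cube_diff\<close>, E^3 times its cofactor is a series in q^3, so
  \<open>adj\<close> carries all of E^(-3) that does not pass through extraction.\<close>

lemma euler_inv_cube: "euler_inv ^ 3 = adj * dil3 (euler_inv ^ 12 * euler3 ^ 3)"
proof -
  have "euler ^ 3 * adj = dil3 jac0 ^ 3 - 27 * jac1 ^ 3"
    unfolding euler_cube adj_def by (simp add: algebra_simps power2_eq_square power3_eq_cube)
  also have "jac1 ^ 3 = dil3 (fps_X * euler3 ^ 9)"
    by (simp add: jac1_def power_mult_distrib dil3_mult dil3_X flip: dil3_power power_mult)
  also have "dil3 jac0 ^ 3 - 27 * \<dots> = dil3 (jac0 ^ 3 - 27 * fps_X * euler3 ^ 9)"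
    by (simp add: dil3_mult dil3_diff dil3_power mult.assoc)
  also have "\<dots> = dil3 (euler ^ 12 * euler3_inv ^ 3)"
    by (simp only: jac0_cube_diff)
  finally have "euler ^ 3 * adj * dil3 (euler_inv ^ 12 * euler3 ^ 3) =
      dil3 ((euler ^ 12 * euler_inv ^ 12) * (euler3 ^ 3 * euler3_inv ^ 3))"
    by (simp add: dil3_mult mult_ac)
  also have "\<dots> = 1"
    by (simp add: euler_power_mult_inv euler3_power_mult_inv)
  finally have "euler_inv ^ 3 * (euler ^ 3 * adj * dil3 (euler_inv ^ 12 * euler3 ^ 3)) = euler_inv ^ 3"
    by simp
  moreover have "euler_inv ^ 3 * (euler ^ 3 * adj * dil3 (euler_inv ^ 12 * euler3 ^ 3)) =
     (euler ^ 3 * euler_inv ^ 3) * (adj * dil3 (euler_inv ^ 12 * euler3 ^ 3))"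
    by (simp only: mult_ac)
  ultimately show ?thesis by (simp add: euler_power_mult_inv)
qed

lemma euler_inv_power:
  "euler_inv ^ (3 * n) = adj ^ n * dil3 (euler_inv ^ (12 * n) * euler3 ^ (3 * n))"
  by (simp add: power_mult euler_inv_cube power_mult_distrib dil3_power dil3_mult)

text \<open>Two binomial expansions, first of a^2 + b (a + b), then of the powers of a + b; the
  exponents of a and b always add up to 2n.\<close>

lemma trinomial_power:
  fixes a b :: "'a :: comm_ring_1"
  shows "(a ^ 2 + a * b + b ^ 2) ^ n =
    (\<Sum>k\<le>n. \<Sum>j\<le>n - k. of_nat ((n choose k) * ((n - k) choose j)) *
       (a ^ (2 * k + j) * b ^ (2 * (n - k) - j)))"
proof -
  have "(a ^ 2 + a * b + b ^ 2) ^ n = (a ^ 2 + b * (a + b)) ^ n"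
    by (simp add: algebra_simps power2_eq_square)
  also have "\<dots> = (\<Sum>k\<le>n. of_nat (n choose k) * (a ^ 2) ^ k * (b ^ (n - k) * (a + b) ^ (n - k)))"
    by (simp only: binomial_ring power_mult_distrib)
  also have "\<dots> = (\<Sum>k\<le>n. \<Sum>j\<le>n - k. of_nat ((n choose k) * ((n - k) choose j)) *
       (a ^ (2 * k + j) * b ^ (2 * (n - k) - j)))"
  proof (intro sum.cong refl)
    fix k
    have "of_nat (n choose k) * (a ^ 2) ^ k * (b ^ (n - k) * (a + b) ^ (n - k)) =
      (\<Sum>j\<le>n - k. of_nat (n choose k) * (a ^ 2) ^ k * (b ^ (n - k) *
         (of_nat ((n - k) choose j) * a ^ j * b ^ (n - k - j))))"
      by (simp only: binomial_ring[of a b] sum_distrib_left)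
    also have "\<dots> = (\<Sum>j\<le>n - k. of_nat ((n choose k) * ((n - k) choose j)) *
       (a ^ (2 * k + j) * b ^ (2 * (n - k) - j)))"
    proof (intro sum.cong refl)
      fix j assume "j \<in> {..n - k}"
      then have "2 * (n - k) - j = (n - k) + (n - k - j)" by simp
      then show "of_nat (n choose k) * (a ^ 2) ^ k * (b ^ (n - k) *
         (of_nat ((n - k) choose j) * a ^ j * b ^ (n - k - j))) =
         of_nat ((n choose k) * ((n - k) choose j)) * (a ^ (2 * k + j) * b ^ (2 * (n - k) - j))"
        by (simp only: power_add power_mult[symmetric] of_nat_mult mult_ac)
    qed
    finally show "of_nat (n choose k) * (a ^ 2) ^ k * (b ^ (n - k) * (a + b) ^ (n - k)) =
      (\<Sum>j\<le>n - k. of_nat ((n choose k) * ((n - k) choose j)) * (a ^ (2 * k + j) * b ^ (2 * (n - k) - j)))" .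
  qed
  finally show ?thesis .
qed

text \<open>Integral polynomials in \<open>tau\<close> without constant term, built termwise to
  allow rule induction. The absent constant term is what yields a factor 9 under extraction.\<close>

inductive_set tau_span :: "int fps set" where
  zero: "0 \<in> tau_span"
| step: "w \<in> tau_span \<Longrightarrow> of_int c * tau ^ Suc i + w \<in> tau_span"

lemma tau_span_add: "v \<in> tau_span \<Longrightarrow> w \<in> tau_span \<Longrightarrow> v + w \<in> tau_span"
  by (induction rule: tau_span.induct) (auto simp: add.assoc simp del: power_Suc intro: tau_span.step)

lemma tau_span_of_int_mult: "w \<in> tau_span \<Longrightarrow> of_int c * w \<in> tau_span"
proof (induction rule: tau_span.induct)
  case (step w d i)
  have "of_int c * (of_int d * tau ^ Suc i + w) = of_int (c * d) * tau ^ Suc i + of_int c * w"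
    by (simp only: of_int_mult distrib_left mult.assoc)
  then show ?case using tau_span.step[OF step.IH, of "c * d" i] by simp
qed (simp add: tau_span.zero)

lemma tau_span_tau_mult: "w \<in> tau_span \<Longrightarrow> tau * w \<in> tau_span"
proof (induction rule: tau_span.induct)
  case (step w d i)
  have "tau * (of_int d * tau ^ Suc i + w) = of_int d * tau ^ Suc (Suc i) + tau * w"
    by (simp add: distrib_left mult_ac)
  then show ?case using tau_span.step[OF step.IH, of d "Suc i"] by simp
qed (simp add: tau_span.zero)

lemma tau_span_power_mult: "tau ^ Suc i * (1 + tau) ^ l \<in> tau_span"
proof (induction l)
  case 0
  show ?case using tau_span.step[OF tau_span.zero, of 1 i] by simp
next
  case (Suc l)
  have "tau ^ Suc i * (1 + tau) ^ Suc l = tau ^ Suc i * (1 + tau) ^ l + tau * (tau ^ Suc i * (1 + tau) ^ l)"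
    by (simp add: algebra_simps)
  then show ?case using tau_span_add[OF Suc.IH tau_span_tau_mult[OF Suc.IH]] by (simp only:)
qed

lemma tau_span_sum: "(\<And>i. i \<in> I \<Longrightarrow> f i \<in> tau_span) \<Longrightarrow> (\<Sum>i\<in>I. f i) \<in> tau_span"
  by (induction I rule: infinite_finite_induct) (auto intro: tau_span_add tau_span.zero)

subsection \<open>Extracting every third coefficient\<close>

definition theta :: "int fps" where
  "theta = 9 * (fps_X ^ 2 * euler_inv ^ 6 * dil3 (euler3 ^ 6))"

text \<open>A term survives only if 2m + r = 3k. Then s = 3(2m - k), so \<open>jac0_cube\<close>
  applies and the term becomes tau^k (1 + tau)^(2m-k). As 3k \<ge> 2m > 3i, at least one
  \<open>tau\<close> remains beside tau^i.\<close>

lemma theta_summand: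
  assumes "3 * i < 2 * m" "s + r = 4 * m"
  shows "\<exists>w\<in>tau_span. 9 ^ m * sec3 0 (fps_X ^ (2 * m) * (dil3 jac0 ^ s * (3 * jac1) ^ r)
     * dil3 (euler_inv ^ (24 * m) * euler3 ^ (12 * m))) = tau ^ i * w"
proof -
  define Q where "Q = jac0 ^ s * euler3 ^ (3 * r) * (euler_inv ^ (24 * m) * euler3 ^ (12 * m))"
  have split: "fps_X ^ (2 * m) * (dil3 jac0 ^ s * (3 * jac1) ^ r) * dil3 (euler_inv ^ (24 * m) * euler3 ^ (12 * m))
     = of_int (3 ^ r) * (dil3 Q * fps_X ^ (2 * m + r))"
    by (simp add: Q_def jac1_def power_mult_distrib power_add dil3_mult dil3_power mult_ac flip: power_mult)
  have eq: "9 ^ m * sec3 0 (fps_X ^ (2 * m) * (dil3 jac0 ^ s * (3 * jac1) ^ r)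
     * dil3 (euler_inv ^ (24 * m) * euler3 ^ (12 * m))) = 9 ^ m * (3 ^ r * (Q * sec3 0 (fps_X ^ (2 * m + r))))"
    unfolding split sec3_of_int_mult by (simp add: sec3_dil3_mult)
  show ?thesis
  proof (cases "3 dvd 2 * m + r")
    case False
    then show ?thesis unfolding eq sec3_X_power by (intro bexI[of _ 0] tau_span.zero) auto
  next
    case True
    then obtain k where k: "2 * m + r = 3 * k" by (rule dvdE)
    with assms have k': "s = 3 * (2 * m - k)" "k \<le> 2 * m" "i < k" by presburger+
    define l where "l = 2 * m - k"
    have l: "s = 3 * l" "l + k = 2 * m" using k' by (auto simp: l_def)
    \<comment> \<open>The 9^m from \<open>theta\<close> and the 3^r from \<open>3 * jac1\<close>
      supply exactly the 27^k of tau^k.\<close>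
    have "(9 :: int fps) ^ m * 3 ^ r = 3 ^ (2 * m + r)"
      by (simp add: power_add power_mult)
    then have c: "(9 :: int fps) ^ m * 3 ^ r = 27 ^ k"
      by (simp add: k power_mult)
    have e1: "24 * m = 12 * l + 12 * k" using l by simp
    have e2: "3 * r + 12 * m = 3 * l + 12 * k" using l k by simp
    have "Q = (euler ^ 12 * euler3_inv ^ 3 * (1 + tau)) ^ l * euler_inv ^ (24 * m) * euler3 ^ (3 * r + 12 * m)"
      unfolding Q_def l power_mult[of jac0] jac0_cube by (simp only: power_add mult_ac)
    also have "\<dots> = (euler ^ (12 * l) * euler_inv ^ (12 * l)) * (euler3 ^ (3 * l) * euler3_inv ^ (3 * l))
        * (1 + tau) ^ l * (euler_inv ^ (12 * k) * euler3 ^ (12 * k))"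
      unfolding e1 e2 by (simp only: power_add power_mult_distrib power_mult[symmetric] mult_ac)
    finally have Q: "Q = (1 + tau) ^ l * (euler_inv ^ (12 * k) * euler3 ^ (12 * k))"
      by (simp only: euler_power_mult_inv euler3_power_mult_inv mult_1_left)
    have "sec3 0 (fps_X ^ (2 * m + r)) = fps_X ^ k"
      by (simp add: k sec3_X_power)
    then have "9 ^ m * (3 ^ r * (Q * sec3 0 (fps_X ^ (2 * m + r)))) = (9 ^ m * 3 ^ r) * Q * fps_X ^ k"
      by (simp only: mult_ac)
    also have "\<dots> = tau ^ k * (1 + tau) ^ l"
      unfolding c Q tau_def[THEN arg_cong, of "\<lambda>x. x ^ k"]
      by (simp only: power_mult_distrib power_mult[symmetric] mult_ac)
    also have "k = i + Suc (k - i - 1)" using k' by simp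
    then have "tau ^ k = tau ^ i * tau ^ Suc (k - i - 1)" by (metis power_add)
    finally have "9 ^ m * (3 ^ r * (Q * sec3 0 (fps_X ^ (2 * m + r)))) = tau ^ i * (tau ^ Suc (k - i - 1) * (1 + tau) ^ l)"
      by (simp only: mult.assoc)
    then show ?thesis unfolding eq using tau_span_power_mult by blast
  qed
qed

text \<open>E^(-6m) is adj^(2m) times a series in q^3; expanding the power of \<open>adj\<close>
  leaves terms covered by \<open>theta_summand\<close>.\<close>

lemma sec3_theta_power:
  assumes "3 * i < 2 * m"
  shows "\<exists>w\<in>tau_span. sec3 0 (theta ^ m) = tau ^ i * w"
proof -
  define n where "n = 2 * m"
  define F where "F k j = fps_X ^ (2 * m) * (dil3 jac0 ^ (2 * k + j) * (3 * jac1) ^ (2 * (n - k) - j))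
     * dil3 (euler_inv ^ (24 * m) * euler3 ^ (12 * m))" for k j
  define c where "c k j = int ((n choose k) * ((n - k) choose j))" for k j
  have "\<exists>w\<in>tau_span. 9 ^ m * sec3 0 (F k j) = tau ^ i * w" if "k \<le> n" "j \<le> n - k" for k j
    unfolding F_def by (rule theta_summand) (use assms that in \<open>auto simp: n_def\<close>)
  then obtain w where w: "\<And>k j. k \<le> n \<Longrightarrow> j \<le> n - k \<Longrightarrow> w k j \<in> tau_span \<and> 9 ^ m * sec3 0 (F k j) = tau ^ i * w k j"
    by metis
  have e: "6 * m = 3 * n" by (simp add: n_def)
  have "theta ^ m = 9 ^ m * (fps_X ^ (2 * m) * euler_inv ^ (6 * m) * dil3 (euler3 ^ (6 * m)))"
    by (simp add: theta_def power_mult_distrib dil3_power flip: power_mult)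
  also have "\<dots> = 9 ^ m * (fps_X ^ (2 * m) * adj ^ n * dil3 (euler_inv ^ (24 * m) * euler3 ^ (12 * m)))"
  proof -
    have "dil3 (euler_inv ^ (12 * n) * euler3 ^ (3 * n)) * dil3 (euler3 ^ (6 * m)) =
        dil3 (euler_inv ^ (24 * m) * euler3 ^ (12 * m))"
      by (simp add: n_def mult.assoc flip: dil3_mult power_add)
    then show ?thesis unfolding e euler_inv_power by (simp only: mult.assoc)
  qed
  also have "\<dots> = of_int (9 ^ m) * (\<Sum>k\<le>n. \<Sum>j\<le>n - k. of_int (c k j) * F k j)"
    unfolding adj_def trinomial_power F_def c_def
    by (simp add: sum_distrib_left sum_distrib_right mult_ac)
  finally have "sec3 0 (theta ^ m) = (\<Sum>k\<le>n. \<Sum>j\<le>n - k. of_int (c k j) * (9 ^ m * sec3 0 (F k j)))"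
    by (simp only: sec3_of_int_mult sec3_sum) (simp add: sum_distrib_left mult_ac)
  also have "\<dots> = (\<Sum>k\<le>n. \<Sum>j\<le>n - k. of_int (c k j) * (tau ^ i * w k j))"
    using w by (intro sum.cong refl) auto
  also have "\<dots> = tau ^ i * (\<Sum>k\<le>n. \<Sum>j\<le>n - k. of_int (c k j) * w k j)"
    by (simp add: sum_distrib_left mult_ac)
  finally have "sec3 0 (theta ^ m) = tau ^ i * (\<Sum>k\<le>n. \<Sum>j\<le>n - k. of_int (c k j) * w k j)" .
  moreover have "(\<Sum>k\<le>n. \<Sum>j\<le>n - k. of_int (c k j) * w k j) \<in> tau_span"
    by (intro tau_span_sum tau_span_of_int_mult) (use w in auto)
  ultimately show ?thesis by blast
qed

lemma tau_mult_dil3_tau: "tau * dil3 tau = 9 * theta ^ 2"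
proof -
  have "tau * dil3 tau =
      27 * 27 * (fps_X * fps_X ^ 3) * (euler3 ^ 12 * euler3_inv ^ 12) * euler_inv ^ 12 * dil3 euler3 ^ 12"
    by (simp only: tau_def euler3_inv_def dil3_mult dil3_numeral dil3_power dil3_X mult_ac)
  also have "\<dots> = 9 * theta ^ 2"
    unfolding euler3_power_mult_inv theta_def
    by (simp add: power_mult_distrib dil3_power flip: power_mult power_Suc)
  finally show ?thesis .
qed

text \<open>After multiplication by tau^i, which enters the extraction as tau(q^3)^i, the argument
  is 9^i times a power of \<open>theta\<close>. The image of that power contains tau^i, which
  cancels.\<close>

lemma sec3_tau_power:
  assumes "a = 1 \<and> i > 0 \<or> a = theta"
  shows "\<exists>w\<in>tau_span. sec3 0 (a * tau ^ i) = 9 ^ i * w"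
proof -
  \<comment> \<open>m is 2i or 2i + 1. For a = 1 the strict inequality 3i < 4i uses i > 0.\<close>
  obtain m where m: "a * theta ^ (2 * i) = theta ^ m" "3 * i < 2 * m"
  proof (cases "a = theta")
    case True
    then show ?thesis by (intro that[of "Suc (2 * i)"]) auto
  next
    case False
    then show ?thesis using assms by (intro that[of "2 * i"]) auto
  qed
  obtain w where w: "w \<in> tau_span" "sec3 0 (theta ^ m) = tau ^ i * w"
    using sec3_theta_power[OF m(2)] by blast
  have "tau ^ i * sec3 0 (a * tau ^ i) = sec3 0 (dil3 (tau ^ i) * (a * tau ^ i))"
    by (simp add: sec3_dil3_mult)
  also have "dil3 (tau ^ i) * (a * tau ^ i) = a * (tau * dil3 tau) ^ i"
    by (simp add: dil3_power power_mult_distrib mult_ac)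
  also have "\<dots> = of_int (9 ^ i) * (a * theta ^ (2 * i))"
    by (simp add: tau_mult_dil3_tau power_mult_distrib power_mult[symmetric] mult_ac)
  also have "sec3 0 \<dots> = of_int (9 ^ i) * (tau ^ i * w)"
    by (simp only: sec3_of_int_mult m(1) w(2))
  finally have "tau ^ i * sec3 0 (a * tau ^ i) = tau ^ i * (9 ^ i * w)"
    by (simp add: mult_ac)
  then show ?thesis using w(1) by (auto simp del: of_int_numeral)
qed

lemma sec3_tau_span:
  assumes "a = 1 \<or> a = theta" "w \<in> tau_span"
  shows "\<exists>v\<in>tau_span. sec3 0 (a * w) = 9 * v"
  using assms(2)
proof (induction rule: tau_span.induct)
  case (step w c i)
  obtain v where v: "v \<in> tau_span" "sec3 0 (a * w) = 9 * v" using step.IH by blast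
  obtain u where u: "u \<in> tau_span" "sec3 0 (a * tau ^ Suc i) = 9 ^ Suc i * u"
    using sec3_tau_power[of a "Suc i"] assms(1) by auto
  have "a * (of_int c * tau ^ Suc i + w) = of_int c * (a * tau ^ Suc i) + a * w"
    by (simp only: distrib_left mult_ac)
  then have "sec3 0 (a * (of_int c * tau ^ Suc i + w)) = of_int c * (9 ^ Suc i * u) + 9 * v"
    by (simp only: sec3_add sec3_of_int_mult u(2) v(2))
  also have "\<dots> = 9 * (of_int (c * 9 ^ i) * u + v)"
    by (simp add: algebra_simps)
  finally show ?case using tau_span_add[OF tau_span_of_int_mult[OF u(1)] v(1)] by blast
qed (auto intro!: bexI[of _ 0] tau_span.zero)


text \<open>\<open>tau\<close> is 27 times an integral series, so its powers beyond the first are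
  divisible by 27^2 = 729.\<close>

lemma tau_span_decomp:
  assumes "w \<in> tau_span"
  shows "\<exists>c v. w = of_int c * tau + 729 * v"
  using assms
proof (induction rule: tau_span.induct)
  case zero
  show ?case by (intro exI[of _ 0]) simp
next
  case (step w d i)
  then obtain c v where w: "w = of_int c * tau + 729 * v" by blast
  show ?case
  proof (cases i)
    case 0
    have "of_int d * tau ^ Suc i + w = of_int (d + c) * tau + 729 * v"
      by (simp add: 0 w algebra_simps)
    then show ?thesis by blast
  next
    case (Suc j)
    define t where "t = fps_X * euler3 ^ 12 * euler_inv ^ 12"
    have "tau ^ Suc i = tau * tau * tau ^ j" by (simp add: Suc)
    also have "tau * tau = 729 * t ^ 2" by (simp add: tau_def t_def power2_eq_square)
    finally have "of_int d * tau ^ Suc i + w = of_int c * tau + 729 * (of_int d * (t ^ 2 * tau ^ j) + v)"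
      by (simp add: w algebra_simps)
    then show ?thesis by blast
  qed
qed

subsection \<open>The tower of generating functions\<close>

text \<open>
  The index of \<^const>\<open>p13\<close> is shifted by one: the coefficients of \<open>q\<^bsup>n+1\<^esup>\<close> in \<open>E(q)\<^sup>-\<^sup>6 stage_even a\<close> and
  \<open>E(q\<^sup>3)\<^sup>-\<^sup>6 stage_odd a\<close> are the values at \<open>9\<^sup>a n + c\<close> and \<open>3 \<cdot> 9\<^sup>a n + c\<close> with \<open>c = (3 \<cdot> 9\<^sup>a + 1)/4\<close>.
  The shift makes both steps extract exponents divisible by 3, the step from
  \<open>stage_even\<close> to \<open>stage_odd\<close> after multiplication by \<open>q\<^sup>2\<close>.
\<close>

fun stage_even :: "nat \<Rightarrow> int fps" and stage_odd :: "nat \<Rightarrow> int fps" where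
  "stage_even 0 = 1"
| "stage_even (Suc a) = sec3 0 (stage_odd a)"
| "stage_odd a = euler3 ^ 6 * sec3 0 (fps_X ^ 2 * (euler_inv ^ 6 * stage_even a))"

declare stage_odd.simps [simp del]

text \<open>The factor E(q^9)^6 of \<open>theta\<close> leaves the extraction as the E(q^3)^6 that
  normalises \<open>stage_odd\<close>.\<close>

lemma nine_mult_stage_odd: "9 * stage_odd a = sec3 0 (theta * stage_even a)"
proof -
  have "theta * stage_even a = 9 * (dil3 (euler3 ^ 6) * (fps_X ^ 2 * (euler_inv ^ 6 * stage_even a)))"
    by (simp only: theta_def mult_ac)
  then show ?thesis by (simp only: sec3_numeral_mult sec3_dil3_mult stage_odd.simps zero_less_numeral)
qed

text \<open>Each extraction after the first gains a 9 by \<open>sec3_tau_span\<close>, but from even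
  to odd it is spent on the 9 in \<open>theta\<close>; the exponent grows only from odd to
  even.\<close>

lemma nine_mult_stage_in_tau_span:
  "\<exists>w\<in>tau_span. 9 * stage_odd a = 9 ^ a * w" "\<exists>w\<in>tau_span. 9 * stage_even (Suc a) = 9 ^ Suc a * w"
proof -
  have G: "\<exists>w\<in>tau_span. 9 * stage_even (Suc a) = 9 ^ Suc a * w"
    if H: "\<exists>w\<in>tau_span. 9 * stage_odd a = 9 ^ a * w" for a
  proof -
    obtain w where w: "w \<in> tau_span" "9 * stage_odd a = 9 ^ a * w" using H by blast
    obtain v where v: "v \<in> tau_span" "sec3 0 (1 * w) = 9 * v"
      using sec3_tau_span[OF _ w(1), of 1] by blast
    have "9 * stage_even (Suc a) = sec3 0 (9 * stage_odd a)" by (simp add: sec3_numeral_mult)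
    also have "\<dots> = sec3 0 (of_int (9 ^ a) * w)" by (simp add: w(2))
    also have "\<dots> = 9 ^ Suc a * v" using v(2) unfolding sec3_of_int_mult by simp
    finally show ?thesis using v(1) by blast
  qed
  show H: "\<exists>w\<in>tau_span. 9 * stage_odd a = 9 ^ a * w"
  proof (induction a)
    case 0
    obtain w where "w \<in> tau_span" "sec3 0 (theta ^ 1) = tau ^ 0 * w"
      using sec3_theta_power[of 0 1] by auto
    then show ?case by (auto simp: nine_mult_stage_odd)
  next
    case (Suc a)
    from G[OF Suc.IH] obtain w where w: "w \<in> tau_span" "9 * stage_even (Suc a) = 9 ^ Suc a * w" by blast
    obtain v where v: "v \<in> tau_span" "sec3 0 (theta * w) = 9 * v"
      using sec3_tau_span[OF _ w(1), of theta] by blast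
    have "9 * (9 * stage_odd (Suc a)) = sec3 0 (theta * (9 * stage_even (Suc a)))"
      by (simp only: nine_mult_stage_odd mult.left_commute[of theta] sec3_numeral_mult)
    also have "\<dots> = sec3 0 (of_int (9 ^ Suc a) * (theta * w))"
      by (simp only: w(2)) (simp add: mult_ac)
    also have "\<dots> = 9 * (9 ^ Suc a * v)"
      using v(2) unfolding sec3_of_int_mult by simp
    finally have "9 * stage_odd (Suc a) = 9 ^ Suc a * v" by simp
    then show ?case using v(1) by blast
  qed
  show "\<exists>w\<in>tau_span. 9 * stage_even (Suc a) = 9 ^ Suc a * w" by (rule G[OF H])
qed

text \<open>Isolates the term linear in \<open>tau\<close>. Cancelling 9 turns 27 and 729 into 3 and
  81; in the even case it lowers 9^(a+1) to 9^a instead.\<close>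

lemma stage_decomp:
  "\<exists>c v. stage_odd a = of_int (9 ^ a) * (of_int (3 * c) * (fps_X * euler3 ^ 12 * euler_inv ^ 12) + 81 * v)"
  "\<exists>c v. stage_even (Suc a) = of_int (9 ^ a) * (of_int (27 * c) * (fps_X * euler3 ^ 12 * euler_inv ^ 12) + 729 * v)"
proof -
  define t where "t = fps_X * euler3 ^ 12 * euler_inv ^ 12"
  have tau: "tau = 27 * t" by (simp add: tau_def t_def)
  obtain w where w: "w \<in> tau_span" "9 * stage_odd a = 9 ^ a * w" using nine_mult_stage_in_tau_span(1) by blast
  then obtain c v where cv: "w = of_int c * tau + 729 * v" using tau_span_decomp by blast
  have "9 * stage_odd a = 9 * (of_int (9 ^ a) * (of_int (3 * c) * t + 81 * v))"
    unfolding w(2) by (simp add: cv tau algebra_simps)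
  then show "\<exists>c v. stage_odd a = of_int (9 ^ a) * (of_int (3 * c) * (fps_X * euler3 ^ 12 * euler_inv ^ 12) + 81 * v)"
    unfolding t_def[symmetric] by (metis mult_left_cancel zero_neq_numeral)
  obtain w where w: "w \<in> tau_span" "9 * stage_even (Suc a) = 9 ^ Suc a * w" using nine_mult_stage_in_tau_span(2) by blast
  then obtain c v where cv: "w = of_int c * tau + 729 * v" using tau_span_decomp by blast
  have "9 * stage_even (Suc a) = 9 * (of_int (9 ^ a) * (of_int (27 * c) * t + 729 * v))"
    unfolding w(2) by (simp add: cv tau algebra_simps)
  then show "\<exists>c v. stage_even (Suc a) = of_int (9 ^ a) * (of_int (27 * c) * (fps_X * euler3 ^ 12 * euler_inv ^ 12) + 729 * v)"
    unfolding t_def[symmetric] by (metis mult_left_cancel zero_neq_numeral)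
qed

text \<open>Makes the divisions by 4 in the indices exact.\<close>

lemma offset_mod: "(3 * 9 ^ a + 1) mod 4 = (0 :: nat)"
proof (induction a)
  case (Suc a)
  have "3 * 9 ^ Suc a + 1 = 9 * (3 * 9 ^ a + 1) - (8 :: nat)" by simp
  then show ?case using Suc.IH by presburger
qed simp

text \<open>The exponent 3(n + 1) is read in both steps. Towards \<open>stage_odd\<close> the factor
  q^2 lowers it to 3n + 1, index 3n; towards \<open>stage_even\<close> it stays, index 3n +
  2.\<close>

lemma stage_nth:
  "(euler_inv ^ 6 * stage_even a) $ Suc n = p13 (9 ^ a * n + (3 * 9 ^ a + 1) div 4)"
  "(euler3_inv ^ 6 * stage_odd a) $ Suc n = p13 (3 * 9 ^ a * n + (3 * 9 ^ a + 1) div 4)"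
proof -
  have H: "(euler3_inv ^ 6 * stage_odd a) $ Suc n = (euler_inv ^ 6 * stage_even a) $ Suc (3 * n)" for a n
  proof -
    have "euler3_inv ^ 6 * stage_odd a = (euler3 ^ 6 * euler3_inv ^ 6) * sec3 0 (fps_X ^ 2 * (euler_inv ^ 6 * stage_even a))"
      unfolding stage_odd.simps by (simp only: mult_ac)
    then show ?thesis
      unfolding euler3_power_mult_inv by (simp add: fps_X_power_mult_nth)
  qed
  have G: "(euler_inv ^ 6 * stage_even (Suc a)) $ Suc n = (euler3_inv ^ 6 * stage_odd a) $ Suc (3 * n + 2)" for a n
  proof -
    have "euler_inv ^ 6 * stage_even (Suc a) = sec3 0 (euler3_inv ^ 6 * stage_odd a)"
      by (simp add: euler3_inv_def sec3_dil3_mult flip: dil3_power)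
    moreover have "3 * Suc n + 0 = Suc (3 * n + 2)" by simp
    ultimately show ?thesis by (simp only: sec3_nth)
  qed
  show *: "(euler_inv ^ 6 * stage_even a) $ Suc n = p13 (9 ^ a * n + (3 * 9 ^ a + 1) div 4)" for n
  proof (induction a arbitrary: n)
    case 0
    show ?case by (simp flip: Abs_fps_p13)
  next
    case (Suc a)
    \<comment> \<open>The next offset is 6 * 9^a + (3 * 9^a + 1)/4 = (27 * 9^a + 1)/4.\<close>
    have "9 ^ a * (3 * (3 * n + 2)) + (3 * 9 ^ a + 1) div 4 = 9 ^ Suc a * n + (3 * 9 ^ Suc a + 1) div (4 :: nat)"
      using offset_mod[of a] by (simp add: algebra_simps)
    then show ?case unfolding G H Suc.IH by (simp only:)
  qed
  show "(euler3_inv ^ 6 * stage_odd a) $ Suc n = p13 (3 * 9 ^ a * n + (3 * 9 ^ a + 1) div 4)"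
    unfolding H * by (simp add: mult_ac)
qed

section \<open>Extra powers of 3 in the term linear in \<open>tau\<close>\<close>

lemma adj_power4: "\<exists>f. adj ^ 4 = dil3 (jac0 ^ 8) + 3 * f"
proof -
  define a where "a = dil3 jac0"
  define h where "h = a * jac1 + 3 * jac1 ^ 2"
  have "adj = a ^ 2 + 3 * h"
    unfolding adj_def a_def[symmetric] h_def by algebra
  then have "adj ^ 4 = a ^ 8 + 3 * (4 * a ^ 6 * h + 18 * a ^ 4 * h ^ 2 + 36 * a ^ 2 * h ^ 3 + 27 * h ^ 4)"
    by algebra
  then show ?thesis unfolding a_def dil3_power by (rule exI)
qed

text \<open>The coefficient of \<open>jac1 ^ 2\<close> in adj^3 is divisible by 27, so modulo 27
  squaring leaves only exponents that are 0 or 1 modulo 3, the latter with coefficient 18.\<close>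

lemma adj_power6: "\<exists>f. adj ^ 6 = dil3 (jac0 ^ 12) + 18 * (fps_X * dil3 (jac0 ^ 11 * euler3 ^ 3)) + 27 * f"
proof -
  define a where "a = dil3 jac0"
  define g where "g = 2 * a ^ 4 * jac1 ^ 2 + 7 * a ^ 3 * jac1 ^ 3 + 18 * a ^ 2 * jac1 ^ 4 + 27 * a * jac1 ^ 5 + 27 * jac1 ^ 6"
  have "adj ^ 3 = a ^ 6 + 9 * a ^ 5 * jac1 + 27 * g"
    unfolding adj_def a_def[symmetric] g_def by algebra
  moreover have "adj ^ 6 = (adj ^ 3) ^ 2" by (simp flip: power_mult)
  ultimately have "adj ^ 6 = a ^ 12 + 18 * (a ^ 11 * jac1) +
      27 * (3 * a ^ 10 * jac1 ^ 2 + 2 * (a ^ 6 + 9 * a ^ 5 * jac1) * g + 27 * g ^ 2)"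
    by algebra
  moreover have "a ^ 11 * jac1 = fps_X * dil3 (jac0 ^ 11 * euler3 ^ 3)"
    by (simp add: a_def jac1_def dil3_mult dil3_power mult_ac)
  moreover have "a ^ 12 = dil3 (jac0 ^ 12)" by (simp add: a_def dil3_power)
  ultimately show ?thesis by (metis (no_types))
qed


text \<open>E^(-12) is adj^4 times a series in q^3. The factor q turns section 2 into section 1 of
  adj^4, which vanishes modulo 3.\<close>

lemma sec3_dvd_hauptmodul: "3 dvd sec3 2 (fps_X * euler3 ^ 12 * euler_inv ^ 12)"
proof -
  obtain f where "adj ^ 4 = dil3 (jac0 ^ 8) + 3 * f" using adj_power4 by blast
  then have "sec3 1 (adj ^ 4) = 3 * sec3 1 f"
    by (simp add: sec3_add sec3_numeral_mult del: One_nat_def)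
  then have "(euler ^ 12 * (euler_inv ^ 48 * euler3 ^ 12)) * sec3 1 (adj ^ 4) =
      3 * (euler ^ 12 * (euler_inv ^ 48 * euler3 ^ 12) * sec3 1 f)"
    by (simp only: mult.left_commute)
  moreover have "fps_X * euler3 ^ 12 * euler_inv ^ 12 =
      fps_X * (dil3 (euler ^ 12 * (euler_inv ^ 48 * euler3 ^ 12)) * adj ^ 4)"
    using euler_inv_power[of 4] by (simp add: euler3_def dil3_mult dil3_power mult_ac)
  then have "sec3 2 (fps_X * euler3 ^ 12 * euler_inv ^ 12) =
      (euler ^ 12 * (euler_inv ^ 48 * euler3 ^ 12)) * sec3 1 (adj ^ 4)"
    by (simp only: sec3_X_mult) (rule sec3_dil3_mult, simp)
  ultimately show ?thesis by (metis dvd_triv_left)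
qed

text \<open>E^(-18) brings in adj^6; the factor q turns sections 2 and 0 into its sections 1 and 2,
  divisible by 9 and 27.\<close>

lemma sec3_dvd_inv_hauptmodul:
  "9 dvd sec3 2 (euler_inv ^ 6 * (fps_X * euler3 ^ 12 * euler_inv ^ 12))"
  "27 dvd sec3 0 (euler_inv ^ 6 * (fps_X * euler3 ^ 12 * euler_inv ^ 12))"
proof -
  define Q where "Q = euler ^ 12 * (euler_inv ^ 72 * euler3 ^ 18)"
  obtain f where f: "adj ^ 6 = dil3 (jac0 ^ 12) + 18 * (fps_X * dil3 (jac0 ^ 11 * euler3 ^ 3)) + 27 * f"
    using adj_power6 by blast
  have "euler_inv ^ 6 * (fps_X * euler3 ^ 12 * euler_inv ^ 12) = fps_X * (euler3 ^ 12 * euler_inv ^ 18)"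
    using power_add[of euler_inv 6 12] by (simp add: mult_ac)
  then have eq: "euler_inv ^ 6 * (fps_X * euler3 ^ 12 * euler_inv ^ 12) = fps_X * (dil3 Q * adj ^ 6)"
    using euler_inv_power[of 6] by (simp add: Q_def euler3_def dil3_mult dil3_power mult_ac)
  have "sec3 2 (euler_inv ^ 6 * (fps_X * euler3 ^ 12 * euler_inv ^ 12)) = Q * sec3 1 (adj ^ 6)"
    unfolding eq sec3_X_mult by (rule sec3_dil3_mult) simp
  also have "\<dots> = 9 * (Q * (2 * (jac0 ^ 11 * euler3 ^ 3) + 3 * sec3 1 f))"
    by (simp only: f sec3_add sec3_numeral_mult sec3_dil3 sec3_X_mult) (simp add: algebra_simps)
  finally show "9 dvd sec3 2 (euler_inv ^ 6 * (fps_X * euler3 ^ 12 * euler_inv ^ 12))" by simp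
  have "sec3 0 (euler_inv ^ 6 * (fps_X * euler3 ^ 12 * euler_inv ^ 12)) = fps_X * (Q * sec3 2 (adj ^ 6))"
    unfolding eq sec3_X_mult by (simp add: sec3_dil3_mult)
  also have "\<dots> = 27 * (fps_X * (Q * sec3 2 f))"
    by (simp only: f sec3_add sec3_numeral_mult sec3_dil3 sec3_X_mult) (simp add: algebra_simps)
  finally show "27 dvd sec3 0 (euler_inv ^ 6 * (fps_X * euler3 ^ 12 * euler_inv ^ 12))" by simp
qed

lemma fps_of_int_dvd_nth: "of_int c dvd f \<Longrightarrow> c dvd f $ n" for f :: "int fps"
  by (auto elim!: dvdE simp flip: fps_of_int)

text \<open>The linear term limits the general bound to 3; section 2 adds another 3 by
  \<open>sec3_dvd_hauptmodul\<close>, as the prefactor is a series in q^3.\<close>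

lemma stage_odd_dvd:
  "of_int (3 * 9 ^ a) dvd euler3_inv ^ 6 * stage_odd a"
  "of_int (9 * 9 ^ a) dvd sec3 2 (euler3_inv ^ 6 * stage_odd a)"
proof -
  define t where "t = fps_X * euler3 ^ 12 * euler_inv ^ 12"
  obtain c v where H: "stage_odd a = of_int (9 ^ a) * (of_int (3 * c) * t + 81 * v)"
    unfolding t_def using stage_decomp(1) by blast
  have "euler3_inv ^ 6 * stage_odd a = of_int (3 * 9 ^ a) * (euler3_inv ^ 6 * (of_int c * t + 27 * v))"
    unfolding H by (simp add: algebra_simps)
  then show "of_int (3 * 9 ^ a) dvd euler3_inv ^ 6 * stage_odd a" by (rule dvdI)
  obtain f where f: "sec3 2 t = 3 * f"
    unfolding t_def using sec3_dvd_hauptmodul by (rule dvdE)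
  have "sec3 2 (euler3_inv ^ 6 * stage_odd a) = euler_inv ^ 6 * sec3 2 (stage_odd a)"
    by (simp add: euler3_inv_def sec3_dil3_mult flip: dil3_power)
  also have "sec3 2 (stage_odd a) = of_int (9 ^ a) * (of_int (3 * c) * (3 * f) + 81 * sec3 2 v)"
    unfolding H by (simp only: sec3_of_int_mult sec3_add sec3_numeral_mult f)
  also have "euler_inv ^ 6 * \<dots> = of_int (9 * 9 ^ a) * (euler_inv ^ 6 * (of_int c * f + 9 * sec3 2 v))"
    by (simp add: algebra_simps)
  finally show "of_int (9 * 9 ^ a) dvd sec3 2 (euler3_inv ^ 6 * stage_odd a)" by (rule dvdI)
qed

text \<open>The prefactor E^(-6) is not a series in q^3 and stays inside the extraction.
  \<open>sec3_dvd_inv_hauptmodul\<close> raises 27 to 27 * 9 and 27 * 27.\<close>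

lemma stage_even_dvd:
  "of_int (27 * 9 ^ a) dvd euler_inv ^ 6 * stage_even (Suc a)"
  "of_int (243 * 9 ^ a) dvd sec3 2 (euler_inv ^ 6 * stage_even (Suc a))"
  "of_int (729 * 9 ^ a) dvd sec3 0 (euler_inv ^ 6 * stage_even (Suc a))"
proof -
  define t where "t = fps_X * euler3 ^ 12 * euler_inv ^ 12"
  obtain c v where "stage_even (Suc a) = of_int (9 ^ a) * (of_int (27 * c) * t + 729 * v)"
    unfolding t_def using stage_decomp(2) by blast
  then have G: "euler_inv ^ 6 * stage_even (Suc a) =
      of_int (9 ^ a) * (of_int (27 * c) * (euler_inv ^ 6 * t) + 729 * (euler_inv ^ 6 * v))"
    by (simp only: distrib_left mult_ac)
  also have "\<dots> = of_int (27 * 9 ^ a) * (euler_inv ^ 6 * (of_int c * t + 27 * v))"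
    by (simp add: algebra_simps)
  finally show "of_int (27 * 9 ^ a) dvd euler_inv ^ 6 * stage_even (Suc a)" by (rule dvdI)
  have sec: "sec3 r (euler_inv ^ 6 * stage_even (Suc a)) = of_int (9 ^ a) *
      (of_int (27 * c) * sec3 r (euler_inv ^ 6 * t) + 729 * sec3 r (euler_inv ^ 6 * v))" for r
    unfolding G by (simp only: sec3_of_int_mult sec3_add sec3_numeral_mult)
  obtain f where f: "sec3 2 (euler_inv ^ 6 * t) = 9 * f"
    unfolding t_def using sec3_dvd_inv_hauptmodul(1) by (rule dvdE)
  have "sec3 2 (euler_inv ^ 6 * stage_even (Suc a)) = of_int (243 * 9 ^ a) * (of_int c * f + 3 * sec3 2 (euler_inv ^ 6 * v))"
    unfolding sec f by (simp add: algebra_simps)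
  then show "of_int (243 * 9 ^ a) dvd sec3 2 (euler_inv ^ 6 * stage_even (Suc a))" by (rule dvdI)
  obtain f where f: "sec3 0 (euler_inv ^ 6 * t) = 27 * f"
    unfolding t_def using sec3_dvd_inv_hauptmodul(2) by (rule dvdE)
  have "sec3 0 (euler_inv ^ 6 * stage_even (Suc a)) = of_int (729 * 9 ^ a) * (of_int c * f + sec3 0 (euler_inv ^ 6 * v))"
    unfolding sec f by (simp add: algebra_simps)
  then show "of_int (729 * 9 ^ a) dvd sec3 0 (euler_inv ^ 6 * stage_even (Suc a))" by (rule dvdI)
qed

text \<open>With \<alpha> = a + 1, the first and fourth congruences come from
  \<open>stage_odd a\<close>, the others from \<open>stage_even (Suc a)\<close>.\<close>

theorem theorem1p1:
  fixes n \<alpha> :: nat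
  assumes "\<alpha> \<ge> 1"
  shows
    "[p13 (3 ^ (2 * \<alpha> - 1) * n + (3 ^ (2 * \<alpha> - 1) + 1) div 4) = 0] (mod 3 ^ (2 * \<alpha> - 1)) \<and>
     [p13 (3 ^ (2 * \<alpha> + 1) * n + (7 * 3 ^ (2 * \<alpha>) + 1) div 4) = 0] (mod 3 ^ (2 * \<alpha> + 3)) \<and>
     [p13 (3 ^ (2 * \<alpha> + 1) * n + (11 * 3 ^ (2 * \<alpha>) + 1) div 4) = 0] (mod 3 ^ (2 * \<alpha> + 4)) \<and>
     [p13 (3 ^ (2 * \<alpha>) * n + (5 * 3 ^ (2 * \<alpha> - 1) + 1) div 4) = 0] (mod 3 ^ (2 * \<alpha>)) \<and>
     [p13 (3 ^ (2 * \<alpha>) * n + (3 ^ (2 * \<alpha> + 1) + 1) div 4) = 0] (mod 3 ^ (2 * \<alpha> + 1))"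
proof -
  obtain a where \<alpha>: "\<alpha> = Suc a" using assms by (cases \<alpha>) auto
  define q :: nat where "q = 9 ^ a"
  define r :: int where "r = 9 ^ a"
  have pow: "(3 :: nat) ^ (2 * \<alpha> - 1) = 3 * q" "(3 :: nat) ^ (2 * \<alpha>) = 9 * q" "(3 :: nat) ^ (2 * \<alpha> + 1) = 27 * q"
    "(3 :: int) ^ (2 * \<alpha> - 1) = 3 * r" "(3 :: int) ^ (2 * \<alpha>) = 9 * r" "(3 :: int) ^ (2 * \<alpha> + 1) = 27 * r"
    "(3 :: int) ^ (2 * \<alpha> + 3) = 243 * r" "(3 :: int) ^ (2 * \<alpha> + 4) = 729 * r"
    by (simp_all add: \<alpha> q_def r_def power_add power_mult)
  have q4: "(3 * q + 1) mod 4 = 0" unfolding q_def by (rule offset_mod)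
  have r1: "3 * r dvd p13 (3 * q * m + (3 * q + 1) div 4)" for m
    using fps_of_int_dvd_nth[OF stage_odd_dvd(1)[of a], of "Suc m"] unfolding stage_nth q_def r_def .
  \<comment> \<open>Exponent 3m + 2 has index 3m + 1 after the shift by one.\<close>
  have r4: "9 * r dvd p13 (3 * q * (3 * m + 1) + (3 * q + 1) div 4)" for m
    using fps_of_int_dvd_nth[OF stage_odd_dvd(2)[of a], of m] stage_nth(2)[of a "3 * m + 1"]
    unfolding q_def r_def by simp
  have r5: "27 * r dvd p13 (9 * q * m + (27 * q + 1) div 4)" for m
    using fps_of_int_dvd_nth[OF stage_even_dvd(1)[of a], of "Suc m"] unfolding stage_nth q_def r_def by simp
  have r2: "243 * r dvd p13 (9 * q * (3 * m + 1) + (27 * q + 1) div 4)" for m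
    using fps_of_int_dvd_nth[OF stage_even_dvd(2)[of a], of m] stage_nth(1)[of "Suc a" "3 * m + 1"]
    unfolding q_def r_def by simp
  have r3: "729 * r dvd p13 (9 * q * (3 * m + 2) + (27 * q + 1) div 4)" for m
  proof -
    have "3 * Suc m + 0 = Suc (3 * m + 2)" by simp
    then have "729 * 9 ^ a dvd (euler_inv ^ 6 * stage_even (Suc a)) $ Suc (3 * m + 2)"
      using fps_of_int_dvd_nth[OF stage_even_dvd(3)[of a], of "Suc m"] by (simp only: sec3_nth)
    then show ?thesis unfolding stage_nth q_def r_def by simp
  qed
  \<comment> \<open>Over the denominator 4 the offsets add up to 36q + 27q = 63q, 72q + 27q = 99q
    and 12q + 3q = 15q.\<close>
  have idx: "9 * q * (3 * n + 1) + (27 * q + 1) div 4 = 27 * q * n + (7 * (9 * q) + 1) div 4"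
    "9 * q * (3 * n + 2) + (27 * q + 1) div 4 = 27 * q * n + (11 * (9 * q) + 1) div 4"
    "3 * q * (3 * n + 1) + (3 * q + 1) div 4 = 9 * q * n + (5 * (3 * q) + 1) div 4"
    unfolding distrib_left mult.assoc using q4 by (simp_all add: mult.left_commute[of q])
  show ?thesis
    unfolding cong_0_iff pow
    using r1[of n] r2[of n] r3[of n] r4[of n] r5[of n] unfolding idx by (intro conjI)
qed

end
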